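(* Let $\alpha>-1$ and let $f^*\in\mathcal{C}(\mathbb{T})$. Suppose that $f\in\mathcal{C}^2(\mathbb{D})$ solves the Dirichlet problem $\Delta_\alpha f=0$ in $\mathbb{D}$, $f=f^*$ on $\mathbb{T}$ (boundary values in the distributional sense), and that $f$ maps $\mathbb{D}$ into $\mathbb{D}$. Then for every $z\in\mathbb{D}$, with $r=|z|$, $$\left|f(z)-\frac{(1-r^2)^{\alpha+1}}{1+r^2}f(0)\right|\le M(r,\alpha),$$ where, if $\alpha\ge 0$, $$M(r,\alpha)=\frac{(1-r^2)^{\alpha+1}\,|(1-r)^{-\alpha}-1|}{1+r^2}+\frac{2^{2+\frac{\alpha}{2}}\, r(1+r^2)^{\frac{\alpha}{2}-1}}{\pi}\;{}_2F_1\left(\frac12,\frac12-\frac{\alpha}{2};\frac32;\frac{4r^2}{(1+r^2)^2}\right),$$ and, if $-1<\alpha<0$, $$M(r,\alpha)=\frac{(1-r^2)^{\alpha+1}\,|(1-r)^{-\alpha}-1|}{1+r^2}+\frac{4r}{\pi}(1+r^2)^{\frac{\alpha}{2}-1}\;{}_2F_1\left(\frac12,\frac12-\frac{\alpha}{2};\frac32;\frac{4r^2}{(1+r^2)^2}\right).$$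
   Context: $\mathbb{D}$ is the open unit disk and $\mathbb{T}$ the unit circle in $\mathbb{C}$; functions are complex-valued; $\mathcal{C}(\mathbb{T})$ is the space of continuous functions on $\mathbb{T}$ and $\mathcal{C}^2(\mathbb{D})$ the space of twice continuously differentiable functions on $\mathbb{D}$. For $\alpha>-1$ the weighted Laplace operator is $\Delta_\alpha=\partial_z(1-|z|^2)^{-\alpha}\overline{\partial}_z$, i.e. $\Delta_\alpha f=\partial_z\big((1-|z|^2)^{-\alpha}\,\overline{\partial}_z f\big)$, where $\partial_z=\frac12(\partial_x-i\partial_y)$ and $\overline{\partial}_z=\frac12(\partial_x+i\partial_y)$. The boundary condition $f=f^*$ on $\mathbb{T}$ means that $f(re^{i\theta})\to f^*(e^{i\theta})$ in the space of distributions $\mathcal{D}'(\mathbb{T})$ as $r\to1^-$. The hypergeometric function is ${}_2F_1(a,b;c;x)=\sum_{n=0}^\infty\frac{(a)_n(b)_n}{(c)_n\,n!}x^n$ for $|x|<1$, where $(a)_0=1$ and $(a)_n=a(a+1)\cdots(a+n-1)$. *)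

theory Defs
  imports "HOL-Analysis.Analysis"
begin

section \<open>Partial derivatives and the class $C^2$\<close>

text \<open>
  Complex-valued functions on the plane are real-differentiated: the Frechet derivative is taken
  over the reals, and its values at \<open>1\<close> and \<open>\<i>\<close> are the partial derivatives in \<open>x\<close> and \<open>y\<close>.
\<close>

definition partial_x :: "(complex \<Rightarrow> complex) \<Rightarrow> complex \<Rightarrow> complex" where
  "partial_x f z = frechet_derivative f (at z) 1"

definition partial_y :: "(complex \<Rightarrow> complex) \<Rightarrow> complex \<Rightarrow> complex" where
  "partial_y f z = frechet_derivative f (at z) \<i>"

definition C1_on :: "complex set \<Rightarrow> (complex \<Rightarrow> complex) \<Rightarrow> bool" where
  "C1_on S f \<longleftrightarrow> (\<forall>z\<in>S. f differentiable (at z)) \<and>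
     continuous_on S (partial_x f) \<and> continuous_on S (partial_y f)"

text \<open>Intended for open sets \<open>S\<close>.\<close>

definition C2_on :: "complex set \<Rightarrow> (complex \<Rightarrow> complex) \<Rightarrow> bool" where
  "C2_on S f \<longleftrightarrow> C1_on S f \<and> C1_on S (partial_x f) \<and> C1_on S (partial_y f)"


section \<open>The weighted Laplacian\<close>

definition wirtinger :: "(complex \<Rightarrow> complex) \<Rightarrow> complex \<Rightarrow> complex" where
  "wirtinger f z = (partial_x f z - \<i> * partial_y f z) / 2"

definition wirtinger_bar :: "(complex \<Rightarrow> complex) \<Rightarrow> complex \<Rightarrow> complex" where
  "wirtinger_bar f z = (partial_x f z + \<i> * partial_y f z) / 2"

definition weighted_laplacian :: "real \<Rightarrow> (complex \<Rightarrow> complex) \<Rightarrow> complex \<Rightarrow> complex" where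
  "weighted_laplacian \<alpha> f =
     wirtinger (\<lambda>w. of_real ((1 - (cmod w)\<^sup>2) powr (- \<alpha>)) * wirtinger_bar f w)"


section \<open>Distributional boundary values on the unit circle\<close>

text \<open>
  A test function on the circle is a function whose pullback under \<open>\<theta> \<mapsto> cis \<theta>\<close> (automatically
  \<open>2 * pi\<close>-periodic) has derivatives of all orders. The values of a test function off the circle
  play no role.
\<close>

definition smooth_real :: "(real \<Rightarrow> complex) \<Rightarrow> bool" where
  "smooth_real u \<longleftrightarrow>
     (\<forall>n t. ((\<lambda>v s. vector_derivative v (at s)) ^^ n) u differentiable (at t))"

definition test_function_circle :: "(complex \<Rightarrow> complex) \<Rightarrow> bool" where
  "test_function_circle \<phi> \<longleftrightarrow> smooth_real (\<lambda>\<theta>. \<phi> (cis \<theta>))"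

text \<open>The action on test functions of the distribution given by a continuous function on the circle.\<close>

definition circle_pairing :: "(complex \<Rightarrow> complex) \<Rightarrow> (complex \<Rightarrow> complex) \<Rightarrow> complex" where
  "circle_pairing g \<phi> =
     integral {0..2 * pi} (\<lambda>\<theta>. g (cis \<theta>) * \<phi> (cis \<theta>)) / of_real (2 * pi)"

definition has_distributional_boundary_value ::
    "(complex \<Rightarrow> complex) \<Rightarrow> (complex \<Rightarrow> complex) \<Rightarrow> bool" where
  "has_distributional_boundary_value f g \<longleftrightarrow>
     (\<forall>\<phi>. test_function_circle \<phi> \<longrightarrow>
       ((\<lambda>r. circle_pairing (\<lambda>\<zeta>. f (of_real r * \<zeta>)) \<phi>) \<longlongrightarrow> circle_pairing g \<phi>) (at_left (1::real)))"


section \<open>The hypergeometric function and the bound\<close>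

definition hypergeo_2F1 :: "real \<Rightarrow> real \<Rightarrow> real \<Rightarrow> real \<Rightarrow> real" where
  "hypergeo_2F1 a b c x = eval_fps (fps_hypergeo [a, b] [c] 1) x"

lemma hypergeo_2F1_series:
  "hypergeo_2F1 a b c x =
     (\<Sum>n. pochhammer a n * pochhammer b n / (pochhammer c n * fact n) * x ^ n)"
  by (simp add: hypergeo_2F1_def eval_fps_def)

definition schwarz_bound :: "real \<Rightarrow> real \<Rightarrow> real" where
  "schwarz_bound r \<alpha> =
     (1 - r\<^sup>2) powr (\<alpha> + 1) * \<bar>(1 - r) powr (- \<alpha>) - 1\<bar> / (1 + r\<^sup>2) +
     (if \<alpha> \<ge> 0 
      then 2 powr (2 + \<alpha> / 2) * r * (1 + r\<^sup>2) powr (\<alpha> / 2 - 1) / pi *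
           hypergeo_2F1 (1/2) (1/2 - \<alpha>/2) (3/2) (4 * r\<^sup>2 / (1 + r\<^sup>2)\<^sup>2)
      else 4 * r / pi * (1 + r\<^sup>2) powr (\<alpha> / 2 - 1) *
           hypergeo_2F1 (1/2) (1/2 - \<alpha>/2) (3/2) (4 * r\<^sup>2 / (1 + r\<^sup>2)\<^sup>2))"

end

theory Submission
  imports Defs "HOL-Complex_Analysis.Cauchy_Integral_Formula"
begin

text \<open>
  The function \<open>(1 - |z|\<^sup>2) powr (- \<alpha>) * wirtinger_bar f z\<close> is the conjugate of a holomorphic \<open>G\<close>, and
  \<open>\<integral>\<^sub>0\<^sup>1 cnj z * (1 - s|z|\<^sup>2) powr \<alpha> * cnj (G (s z)) ds\<close> has the same \<open>wirtinger_bar\<close> derivative as \<open>f\<close>.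
  Subtracting it leaves a holomorphic function, so \<open>f\<close> is a series in \<open>z ^ n\<close> and
  \<open>cnj z ^ (n + 1)\<close>, the latter with incomplete beta functions of \<open>|z|\<^sup>2\<close> as weights. Pairing \<open>f\<close> on circles of
  radius tending to 1 with partial sums of the weighted Poisson kernel \<open>P\<close> gives, since \<open>|f| \<le> 1\<close>,
  \<open>|f z - c * f 0| \<le> (1 / 2\<pi>) \<integral> |P - c|\<close> for the constant \<open>c = (1 - r\<^sup>2) powr (\<alpha> + 1) / (1 + r\<^sup>2)\<close>.
  Finally \<open>|P - c|\<close> is estimated pointwise, and folding \<open>t \<mapsto> t + \<pi>\<close> turns the integral into the
  hypergeometric function.
\<close>

section \<open>Series and hypergeometric integrals\<close>

text \<open>With D = |1 - z|^2 and V = (1 - cnj z)^(-\<alpha>), the kernel is (1 - r^2)^(\<alpha>+1)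
  V / D. On the imaginary axis D = 1 + r^2, so \<open>c\<close> is what remains there once V is
  replaced by 1, and 1 + r^2 - D = 2 Re z. The obstacle is the complex factor V: the difference V -
  1 produces the first term of the bound, while the part proportional to Re z, with |V| =
  D^(-\<alpha>/2), produces the hypergeometric term.

  The two cases of the bound come from the folding. Over a common denominator, opposite points
  contribute (1 - y)^p + (1 + y)^p with p = 1 + \<alpha>/2, whose supremum over 0 <= y < 1 is 2 for
  p <= 1 and 2^p for p >= 1.

  Partial sums are paired because on a circle of radius \<rho> < 1 the conjugate terms carry
  incomplete beta weights at \<rho>^2. A finite sum needs only the limit of each weight as \<rho>
  tends to 1, and the kernel coefficients contain the reciprocals of these limits.\<close>

lemma sums_integral_Weierstrass:
  fixes u :: "nat \<Rightarrow> real \<Rightarrow> 'a::banach"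
  assumes cont: "\<And>n. continuous_on {a..b} (u n)"
    and bound: "\<And>n t. t \<in> {a..b} \<Longrightarrow> norm (u n t) \<le> M n"
    and "summable M"
  shows "(\<lambda>n. integral {a..b} (u n)) sums integral {a..b} (\<lambda>t. \<Sum>n. u n t)"
proof -
  have "uniform_limit {a..b} (\<lambda>n t. \<Sum>i<n. u i t) (\<lambda>t. \<Sum>n. u n t) sequentially"
    by (rule Weierstrass_m_test) (use assms in auto)
  then obtain I J where IJ: "\<And>n. ((\<lambda>t. \<Sum>i<n. u i t) has_integral I n) {a..b}"
      "((\<lambda>t. \<Sum>n. u n t) has_integral J) {a..b}" "I \<longlonglongrightarrow> J"
    by (rule uniform_limit_integral) (auto intro!: continuous_on_sum cont)
  have "I = (\<lambda>n. \<Sum>i<n. integral {a..b} (u i))"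
  proof
    fix n
    show "I n = (\<Sum>i<n. integral {a..b} (u i))"
    using IJ(1)[of n] by (subst integral_sum[symmetric])
      (auto intro: integrable_continuous_real cont simp: integral_unique)
  qed
  with IJ(2,3) show ?thesis
    by (simp add: sums_def integral_unique)
qed

section \<open>Binomial series with real exponent and the signs of their coefficients\<close>

lemma binomial_series_complex:
  fixes b :: real and w :: complex
  assumes "norm w < 1"
  shows "(\<lambda>n. of_real (pochhammer b n / fact n) * w ^ n) sums ((1 - w) powr of_real (- b))"
proof -
  have "(of_real (- b) gchoose n) * (- w) ^ n = of_real (pochhammer b n / fact n) * w ^ n" for n
    unfolding gbinomial_pochhammer power_minus[of w] by (simp add: pochhammer_of_real)
  then show ?thesis
    using gen_binomial_complex[of "- w" "of_real (- b)"] assms by simp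
qed

lemma binomial_series_real:
  fixes b x :: real
  assumes "\<bar>x\<bar> < 1"
  shows "(\<lambda>n. pochhammer b n / fact n * x ^ n) sums ((1 - x) powr - b)"
proof -
  have "(- b gchoose n) * (- x) ^ n = pochhammer b n / fact n * x ^ n" for n
    unfolding gbinomial_pochhammer power_minus[of x] by simp
  then show ?thesis
    using gen_binomial_real[of "- x" "- b"] assms by simp
qed

text \<open>Convergence at the midpoint of y and 1 forces absolute convergence at y. This is the
  majorant in the later exchanges of sum and integral.\<close>

lemma summable_abs_binomial_series:
  fixes b y :: real
  assumes "0 \<le> y" "y < 1"
  shows "summable (\<lambda>n. \<bar>pochhammer b n / fact n\<bar> * y ^ n)"
proof -
  have "summable (\<lambda>n. norm (pochhammer b n / fact n * y ^ n))"
  proof (rule powser_insidea)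
    show "summable (\<lambda>n. pochhammer b n / fact n * ((1 + y) / 2) ^ n)"
      using assms by (intro sums_summable[OF binomial_series_real]) auto
    show "norm y < norm ((1 + y) / 2)" using assms by simp
  qed
  then show ?thesis using assms(1) by (simp add: abs_mult power_abs)
qed

text \<open>The first factor of the product is \<alpha> and the remaining ones are positive because
  \<alpha> + 1 > 0, so \<alpha> alone decides the sign.\<close>

lemma pochhammer_sign:
  fixes \<alpha> :: real
  assumes "\<alpha> > -1"
  shows "\<alpha> \<ge> 0 \<Longrightarrow> pochhammer \<alpha> n \<ge> 0"
    and "\<alpha> \<le> 0 \<Longrightarrow> n > 0 \<Longrightarrow> pochhammer \<alpha> n \<le> 0"
proof -
  show "pochhammer \<alpha> n \<ge> 0" if "\<alpha> \<ge> 0" using that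
    by (cases "\<alpha> = 0") (simp_all add: pochhammer_0_left less_imp_le pochhammer_pos)
next
  assume "\<alpha> \<le> 0" "n > 0"
  then obtain m where "n = Suc m" by (cases n) auto
  moreover have "pochhammer (\<alpha> + 1) m \<ge> 0" using assms by (intro less_imp_le pochhammer_pos) auto
  ultimately show "pochhammer \<alpha> n \<le> 0" using \<open>\<alpha> \<le> 0\<close>
    by (simp add: pochhammer_rec mult_nonpos_nonneg)
qed

text \<open>The Taylor coefficients of \<open>(1 - w) powr (- \<alpha>) - 1\<close> all have the same sign.\<close>

lemma norm_one_minus_powr_minus_one_le:
  fixes \<alpha> :: real and w :: complex
  assumes "\<alpha> > -1" "norm w < 1"
  shows "norm ((1 - w) powr of_real (- \<alpha>) - 1) \<le> \<bar>(1 - norm w) powr (- \<alpha>) - 1\<bar>"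
proof -
  \<comment> \<open>Indexing starts at degree 1: the constant coefficient is 1 for every \<alpha>,
    whereas all later ones follow the sign of \<alpha>.\<close>
  define c where "c n = pochhammer \<alpha> (Suc n) / fact (Suc n)" for n
  have cx: "(\<lambda>n. of_real (c n) * w ^ Suc n) sums ((1 - w) powr of_real (- \<alpha>) - 1)"
    using binomial_series_complex[OF assms(2), of \<alpha>] unfolding c_def
    by (subst sums_Suc_iff) simp
  have re: "(\<lambda>n. c n * norm w ^ Suc n) sums ((1 - norm w) powr (- \<alpha>) - 1)"
    using binomial_series_real[of "norm w" \<alpha>] assms(2)
    unfolding c_def by (subst sums_Suc_iff) simp
  obtain s :: real where s: "\<bar>s\<bar> = 1" "\<And>n. \<bar>c n\<bar> = s * c n"
  proof (cases "\<alpha> \<ge> 0")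
    case True
    then show ?thesis using pochhammer_sign[OF assms(1)] that[of 1] by (auto simp: c_def)
  next
    case False
    then show ?thesis using pochhammer_sign(2)[OF assms(1), of "Suc n" for n] that[of "-1"]
      by (auto simp: c_def divide_nonpos_pos)
  qed
  have re': "(\<lambda>n. norm (of_real (c n) * w ^ Suc n)) sums (s * ((1 - norm w) powr (- \<alpha>) - 1))"
    using sums_mult[OF re, of s] by (simp add: norm_mult norm_power s(2) mult.assoc)
  have "norm ((1 - w) powr of_real (- \<alpha>) - 1) \<le> s * ((1 - norm w) powr (- \<alpha>) - 1)"
    using summable_norm[OF sums_summable[OF re']] sums_unique[OF cx] sums_unique[OF re'] by simp
  also have "\<dots> \<le> \<bar>(1 - norm w) powr (- \<alpha>) - 1\<bar>"
    using s(1) abs_ge_self[of "s * ((1 - norm w) powr (- \<alpha>) - 1)"] unfolding abs_mult by simp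
  finally show ?thesis .
qed

text \<open>By concavity x^p lies below its tangent at 1 (Young's inequality with second factor 1),
  and the tangent values at 1 - y and 1 + y add up to 2.\<close>

lemma one_minus_plus_powr_le_two:
  fixes y p :: real
  assumes "0 \<le> y" "y < 1" "0 \<le> p" "p \<le> 1"
  shows "(1 - y) powr p + (1 + y) powr p \<le> 2"
proof -
  have *: "x powr p \<le> 1 + p * (x - 1)" if "x > 0" for x :: real
    using that assms(3,4) Youngs_inequality_0[of p "1 - p" x 1] by (simp add: algebra_simps)
  show ?thesis using *[of "1-y"] *[of "1+y"] assms by (simp add: algebra_simps)
qed

text \<open>After division by 2 both bases lie in (0, 1] and sum to 1, and an exponent p >= 1 can
  only decrease them. The constant is approached as y tends to 1.\<close>

lemma one_minus_plus_powr_le_two_powr: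
  fixes y p :: real
  assumes "0 \<le> y" "y < 1" "1 \<le> p"
  shows "(1 - y) powr p + (1 + y) powr p \<le> 2 powr p"
proof -
  have *: "(x / 2) powr p \<le> x / 2" if "0 < x" "x \<le> 2" for x :: real
    using powr_mono'[of 1 p "x / 2"] that assms by simp
  have "(1 - y) powr p + (1 + y) powr p = 2 powr p * (((1 - y) / 2) powr p + ((1 + y) / 2) powr p)"
    using assms by (simp add: powr_divide field_simps)
  also have "\<dots> \<le> 2 powr p * 1"
    using *[of "1-y"] *[of "1+y"] assms by (intro mult_left_mono) auto
  finally show ?thesis by simp
qed

text \<open>Euler's integral for the parameters 1/2 and 3/2, with its variable replaced by v^2. It
  is obtained by integrating the binomial series termwise, where 1/(2n+1) is the quotient of the
  Pochhammer symbols of 1/2 and 3/2.\<close>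

lemma hypergeo_2F1_half_integral:
  fixes b x :: real
  assumes "0 \<le> x" "x < 1"
  shows "integral {0..1} (\<lambda>v. (1 - x\<^sup>2 * v\<^sup>2) powr (- b)) = hypergeo_2F1 (1/2) b (3/2) (x\<^sup>2)"
proof -
  define u where "u n v = pochhammer b n / fact n * (x\<^sup>2 * v\<^sup>2) ^ n" for n and v :: real
  have x2: "x\<^sup>2 < 1" using assms by (simp add: power_less_one_iff abs_square_less_1)
  have uv: "x\<^sup>2 * v\<^sup>2 \<le> x\<^sup>2" if "v \<in> {0..1}" for v
    using that by (simp add: mult_left_le power_le_one)
  have sm: "summable (\<lambda>n. \<bar>pochhammer b n / fact n\<bar> * (x\<^sup>2) ^ n)"
    using x2 by (intro summable_abs_binomial_series) auto
  have "(\<lambda>n. integral {0..1} (u n)) sums integral {0..1} (\<lambda>v. \<Sum>n. u n v)"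
  proof (rule sums_integral_Weierstrass[OF _ _ sm])
    show "continuous_on {0..1} (u n)" for n unfolding u_def by (intro continuous_intros)
    show "norm (u n t) \<le> \<bar>pochhammer b n / fact n\<bar> * (x\<^sup>2) ^ n" if "t \<in> {0..1}" for n t
      unfolding u_def real_norm_def abs_mult using uv[OF that]
      by (intro mult_left_mono) (simp_all add: power_abs power_mono)
  qed
  moreover have "integral {0..1} (\<lambda>v. \<Sum>n. u n v) = integral {0..1} (\<lambda>v. (1 - x\<^sup>2 * v\<^sup>2) powr (- b))"
  proof (rule integral_cong)
    fix v :: real assume "v \<in> {0..1}"
    then have "\<bar>x\<^sup>2 * v\<^sup>2\<bar> < 1" using uv[of v] x2 by simp
    then show "(\<Sum>n. u n v) = (1 - x\<^sup>2 * v\<^sup>2) powr (- b)"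
      using sums_unique[OF binomial_series_real[of "x\<^sup>2 * v\<^sup>2" b]] by (simp add: u_def)
  qed
  moreover have "integral {0..1} (u n) =
      pochhammer (1/2) n * pochhammer b n / (pochhammer (3/2) n * fact n) * (x\<^sup>2) ^ n" for n
  proof -
    have *: "pochhammer (3/2) n = (2 * real n + 1) * pochhammer (1/2 :: real) n" for n
      by (induction n) (auto simp: pochhammer_Suc field_simps)
    have "((\<lambda>v::real. v ^ (2 * n)) has_integral 1 / (2 * real n + 1)) {0..1}"
    proof -
      have "((\<lambda>v::real. v ^ (2*n+1) / (2 * real n + 1)) has_vector_derivative v ^ (2*n)) (at v within {0..1})" for v
        unfolding has_real_derivative_iff_has_vector_derivative[symmetric]
        using DERIV_cdivide[OF DERIV_pow[of "2*n+1" v "{0..1}"], of "2 * real n + 1"]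
        by (simp add: add.commute)
      from fundamental_theorem_of_calculus[OF _ this] show ?thesis by simp
    qed
    from has_integral_mult_right[OF this, of "pochhammer b n / fact n * (x\<^sup>2) ^ n"]
    have "integral {0..1} (u n) = pochhammer b n / fact n * (x\<^sup>2) ^ n * (1 / (2 * real n + 1))"
      by (intro integral_unique) (simp add: u_def[abs_def] power_mult_distrib mult_ac flip: power_mult)
    moreover have "pochhammer (1/2::real) n \<noteq> 0" by (intro less_imp_neq[symmetric] pochhammer_pos) auto
    moreover have "2 * real n + 1 \<noteq> 0" by linarith
    ultimately show ?thesis by (simp add: *)
  qed
  ultimately show ?thesis unfolding hypergeo_2F1_series by (simp add: sums_unique)
qed

text \<open>Substituting the sine alone would lead to the argument -x^2/(1 - x^2), which leaves the
  disc of convergence once x^2 >= 1/2. Pfaff's transformation brings the argument back to x^2,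
  replaces the parameter p by 3/2 - p and yields the power of 1 - x^2 in front.\<close>

lemma has_integral_cos_powr_hypergeo:
  fixes x p :: real
  assumes x: "0 \<le> x" "x < 1"
  shows "((\<lambda>t. cos t * (1 - x\<^sup>2 * (cos t)\<^sup>2) powr (- p)) has_integral
           2 * (1 - x\<^sup>2) powr (1/2 - p) * hypergeo_2F1 (1/2) (3/2 - p) (3/2) (x\<^sup>2)) {- (pi/2)..pi/2}"
proof -
  have x2: "x\<^sup>2 < 1" using assms by (simp add: power_less_one_iff abs_square_less_1)
  \<comment> \<open>After \<open>u = sin t\<close>, the substitution \<open>u = g v\<close> plays the role of Pfaff's transformation.\<close>
  define f where "f u = (1 - x\<^sup>2 + x\<^sup>2 * u\<^sup>2) powr (- p)" for u
  define g where "g v = v * sqrt (1 - x\<^sup>2) / sqrt (1 - x\<^sup>2 * v\<^sup>2)" for v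
  define k where "k v = (1 - x\<^sup>2 * v\<^sup>2) powr (p - 3/2)" for v
  have pos: "1 - x\<^sup>2 + x\<^sup>2 * u\<^sup>2 > 0" for u :: real
    using x2 by (simp add: add_pos_nonneg)
  have pos': "1 - x\<^sup>2 * v\<^sup>2 > 0" if "v \<in> {-1..1}" for v :: real
  proof -
    have "v\<^sup>2 \<le> 1" using that by (simp add: abs_square_le_1 abs_le_iff)
    then have "x\<^sup>2 * v\<^sup>2 \<le> x\<^sup>2" by (simp add: mult_left_le)
    then show ?thesis using x2 by simp
  qed
  have contf: "continuous_on S f" for S
    unfolding f_def using pos by (intro continuous_intros) (auto simp: less_imp_neq[symmetric] dest: less_imp_neq)
  have contk: "continuous_on {-1..1} k"
    unfolding k_def by (intro continuous_intros) (metis pos' less_irrefl)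
  have "((\<lambda>t. cos t *\<^sub>R f (sin t)) has_integral integral {sin (- (pi/2))..sin (pi/2)} f) {- (pi/2)..pi/2}"
    by (rule has_integral_substitution[where c = "-1" and d = 1])
       (auto intro!: contf derivative_eq_intros)
  then have 1: "((\<lambda>t. cos t * (1 - x\<^sup>2 * (cos t)\<^sup>2) powr (- p)) has_integral integral {-1..1} f) {- (pi/2)..pi/2}"
    by (simp add: f_def cos_squared_eq algebra_simps)
  have g1: "g (-1) = -1" "g 1 = 1"
  proof -
    have "sqrt (1 - x\<^sup>2) > 0" using pos[of 0] by simp
    then show "g (-1) = -1" "g 1 = 1" by (simp_all only: g_def) simp_all
  qed
  have g_le: "\<bar>g v\<bar> \<le> 1" if v: "v \<in> {-1..1}" for v
  proof -
    have "v\<^sup>2 \<le> 1" using v by (simp add: abs_square_le_1 abs_le_iff)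
    then have "(g v)\<^sup>2 \<le> 1"
      using pos'[OF v] x2 unfolding g_def by (simp add: power_divide power_mult_distrib field_simps)
    then show ?thesis by (simp add: abs_square_le_1)
  qed
  have deriv: "(g has_field_derivative sqrt (1 - x\<^sup>2) * (1 - x\<^sup>2 * v\<^sup>2) powr (- (3/2))) (at v within {-1..1})"
    if v: "v \<in> {-1..1}" for v
  proof -
    define q where "q = sqrt (1 - x\<^sup>2 * v\<^sup>2)"
    have q: "q > 0" "q\<^sup>2 = 1 - x\<^sup>2 * v\<^sup>2" using pos'[OF v] by (auto simp: q_def)
    have "(1 - x\<^sup>2 * v\<^sup>2) powr (- (3/2)) = (q powr 2) powr (- (3/2))" using q by simp
    also have "\<dots> = q powr (- 3)" by (simp only: powr_powr) simp
    also have "\<dots> = 1 / q ^ 3" using q(1) unfolding powr_minus_divide by simp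
    finally have q3: "(1 - x\<^sup>2 * v\<^sup>2) powr (- (3/2)) = 1 / q ^ 3" .
    have "(g has_field_derivative
        (sqrt (1 - x\<^sup>2) * q - v * sqrt (1 - x\<^sup>2) * (- (x\<^sup>2 * (2 * v)) / (2 * q))) / (q * q)) (at v within {-1..1})"
      unfolding g_def using pos'[OF v] q(1) unfolding q_def
      by (auto intro!: derivative_eq_intros simp: field_simps)
    \<comment> \<open>The numerator collapses because q^2 + x^2 v^2 = 1.\<close>
    moreover have "(sqrt (1 - x\<^sup>2) * q - v * sqrt (1 - x\<^sup>2) * (- (x\<^sup>2 * (2 * v)) / (2 * q))) / (q * q)
        = sqrt (1 - x\<^sup>2) * (q\<^sup>2 + x\<^sup>2 * v\<^sup>2) / q ^ 3"
      using q(1) by (simp add: field_simps power2_eq_square power3_eq_cube)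
    ultimately show ?thesis using q q3 by simp
  qed
  have "((\<lambda>v. (sqrt (1 - x\<^sup>2) * (1 - x\<^sup>2 * v\<^sup>2) powr (- (3/2))) *\<^sub>R f (g v)) has_integral integral {g (-1)..g 1} f) {-1..1}"
  proof (rule has_integral_substitution[where c = "-1" and d = 1])
    show "g (-1) \<le> g 1" unfolding g1 by simp
    show "g ` {-1..1} \<subseteq> {-1..1}" using g_le by (simp add: image_subset_iff abs_le_iff)
  qed (use contf deriv in auto)
  then have "((\<lambda>v. (sqrt (1 - x\<^sup>2) * (1 - x\<^sup>2 * v\<^sup>2) powr (- (3/2))) *\<^sub>R f (g v)) has_integral integral {-1..1} f) {-1..1}"
    unfolding g1 .
  moreover have "(sqrt (1 - x\<^sup>2) * (1 - x\<^sup>2 * v\<^sup>2) powr (- (3/2))) *\<^sub>R f (g v) = (1 - x\<^sup>2) powr (1/2 - p) * k v"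
    if v: "v \<in> {-1..1}" for v
  proof -
    \<comment> \<open>This identity is the reason for the choice of \<open>g\<close>: the sum inside
      the power becomes a quotient, so the power splits into a constant and a power of 1 - x^2
      v^2.\<close>
    have "1 - x\<^sup>2 + x\<^sup>2 * (g v)\<^sup>2 = (1 - x\<^sup>2) / (1 - x\<^sup>2 * v\<^sup>2)"
      using pos'[OF v] x2 by (simp add: g_def power_divide power_mult_distrib field_simps)
    then have "f (g v) = (1 - x\<^sup>2) powr (- p) * (1 - x\<^sup>2 * v\<^sup>2) powr p"
      using pos'[OF v] x2 by (simp add: f_def powr_divide powr_minus_divide)
    moreover have "(1 - x\<^sup>2) powr (1/2 - p) = sqrt (1 - x\<^sup>2) * (1 - x\<^sup>2) powr (- p)"
      using powr_add[of "1 - x\<^sup>2" "1/2" "- p"] x2 by (simp add: powr_half_sqrt)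
    moreover have "k v = (1 - x\<^sup>2 * v\<^sup>2) powr p * (1 - x\<^sup>2 * v\<^sup>2) powr (- (3/2))"
      using powr_add[of "1 - x\<^sup>2 * v\<^sup>2" p "- (3/2)"] by (simp add: k_def)
    ultimately show ?thesis by simp
  qed
  ultimately have "((\<lambda>v. (1 - x\<^sup>2) powr (1/2 - p) * k v) has_integral integral {-1..1} f) {-1..1}"
    by (metis (no_types, lifting) has_integral_cong)
  then have 2: "integral {-1..1} f = (1 - x\<^sup>2) powr (1/2 - p) * integral {-1..1} k"
    by (metis integral_mult_right integral_unique)
  have "integral {-1..1} k = integral {-1..0} k + integral {0..1} k"
    using contk by (intro Henstock_Kurzweil_Integration.integral_combine[symmetric] integrable_continuous_real) auto
  moreover have "integral {-1..0} k = integral {0..1} k"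
    using Henstock_Kurzweil_Integration.integral_reflect_real[of "0" "-1" k] by (simp add: k_def[abs_def])
  moreover have "integral {0..1} k = hypergeo_2F1 (1/2) (3/2 - p) (3/2) (x\<^sup>2)"
    using hypergeo_2F1_half_integral[OF x, of "3/2 - p"] by (simp add: k_def[abs_def])
  ultimately show ?thesis using 1 2 by (simp add: mult_ac)
qed

text \<open>The period starts at -pi/2 so that cos keeps one sign on each half. Shifting the second
  half by pi turns 1 - y into 1 + y, where y = x cos t, and (1-y)^(-p) + (1+y)^(-p) = ((1-y)^p +
  (1+y)^p) (1-y^2)^(-p). Only the first factor is estimated; the remaining integral is known
  exactly.\<close>

lemma integral_abs_cos_powr_le:
  fixes x p C :: real
  assumes x: "0 \<le> x" "x < 1" and "p \<ge> 0"
    and C: "\<And>y. 0 \<le> y \<Longrightarrow> y < 1 \<Longrightarrow> (1 - y) powr p + (1 + y) powr p \<le> C"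
  shows "integral {- (pi/2)..3*pi/2} (\<lambda>t. \<bar>cos t\<bar> * (1 - x * cos t) powr (- p))
           \<le> 2 * C * (1 - x\<^sup>2) powr (1/2 - p) * hypergeo_2F1 (1/2) (3/2 - p) (3/2) (x\<^sup>2)"
proof -
  define h where "h t = \<bar>cos t\<bar> * (1 - x * cos t) powr (- p)" for t
  have xc: "\<bar>x * cos t\<bar> < 1" for t
  proof -
    have "\<bar>x * cos t\<bar> \<le> x * 1" unfolding abs_mult using x by (intro mult_mono) auto
    then show ?thesis using x by simp
  qed
  have pos: "1 - x * cos t > 0" "1 + x * cos t > 0" for t using xc[of t] by linarith+
  have conth: "continuous_on S h" for S
    unfolding h_def using pos by (intro continuous_intros) (auto dest: less_imp_neq)
  have conth': "continuous_on S (\<lambda>t. h (t + pi))" for S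
    by (rule continuous_on_compose2[OF conth[of UNIV]]) (auto intro!: continuous_intros)
  have "((\<lambda>t. 1 *\<^sub>R h (t + pi)) has_integral integral {- (pi/2) + pi..pi/2 + pi} h) {- (pi/2)..pi/2}"
    by (rule has_integral_substitution[where c = "- (pi/2) + pi" and d = "pi/2 + pi"])
       (auto intro!: conth derivative_eq_intros)
  then have sh: "integral {pi/2..3*pi/2} h = integral {- (pi/2)..pi/2} (\<lambda>t. h (t + pi))"
    by (simp add: integral_unique field_simps)
  have "integral {- (pi/2)..3*pi/2} h = integral {- (pi/2)..pi/2} h + integral {pi/2..3*pi/2} h"
    using conth by (intro Henstock_Kurzweil_Integration.integral_combine[symmetric] integrable_continuous_real) auto
  also have "\<dots> = integral {- (pi/2)..pi/2} (\<lambda>t. h t + h (t + pi))"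
    unfolding sh by (rule Henstock_Kurzweil_Integration.integral_add[symmetric])
      (auto intro!: integrable_continuous_real conth conth')
  also have "\<dots> \<le> integral {- (pi/2)..pi/2} (\<lambda>t. C * (cos t * (1 - x\<^sup>2 * (cos t)\<^sup>2) powr (- p)))"
  proof (rule integral_le)
    show "(\<lambda>t. h t + h (t + pi)) integrable_on {- (pi/2)..pi/2}"
      by (intro integrable_continuous_real continuous_intros conth conth')
    show "(\<lambda>t. C * (cos t * (1 - x\<^sup>2 * (cos t)\<^sup>2) powr (- p))) integrable_on {- (pi/2)..pi/2}"
      using has_integral_cos_powr_hypergeo[OF x, of p] by (intro integrable_on_mult_right) blast
  next
    fix t assume "t \<in> {- (pi/2)..pi/2}"
    then have c: "cos t \<ge> 0" by (intro cos_ge_zero) auto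
    define y where "y = x * cos t"
    have y: "0 \<le> y" "y < 1" using c x xc[of t] by (auto simp: y_def)
    have "(1 - y) powr (- p) + (1 + y) powr (- p) = ((1 - y) powr p + (1 + y) powr p) * (1 - y\<^sup>2) powr (- p)"
    proof -
      have "1 - y\<^sup>2 = (1 - y) * (1 + y)" by (simp add: power2_eq_square algebra_simps)
      then have "(1 - y\<^sup>2) powr (- p) = (1 - y) powr (- p) * (1 + y) powr (- p)"
        using y by (simp only: powr_mult)
      moreover have "(1 - y) powr p * (1 - y) powr (- p) = 1" "(1 + y) powr p * (1 + y) powr (- p) = 1"
        using y by (simp_all flip: powr_add)
      ultimately show ?thesis by algebra
    qed
    also have "\<dots> \<le> C * (1 - y\<^sup>2) powr (- p)"
      by (intro mult_right_mono C y) auto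
    finally have "cos t * ((1 - y) powr (- p) + (1 + y) powr (- p)) \<le> cos t * (C * (1 - y\<^sup>2) powr (- p))"
      using c by (rule mult_left_mono)
    moreover have "h t + h (t + pi) = cos t * ((1 - y) powr (- p) + (1 + y) powr (- p))"
      using c by (simp add: h_def y_def algebra_simps)
    ultimately show "h t + h (t + pi) \<le> C * (cos t * (1 - x\<^sup>2 * (cos t)\<^sup>2) powr (- p))"
      by (simp add: y_def power_mult_distrib mult_ac)
  qed
  also have "\<dots> = C * (2 * (1 - x\<^sup>2) powr (1/2 - p) * hypergeo_2F1 (1/2) (3/2 - p) (3/2) (x\<^sup>2))"
    using has_integral_cos_powr_hypergeo[OF x, of p] by (intro integral_unique has_integral_mult_right)
  finally show ?thesis by (simp add: h_def[abs_def] mult_ac)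
qed

lemma schwarz_bound_integral:
  fixes r \<alpha> :: real
  assumes r: "0 \<le> r" "r < 1" and \<alpha>: "\<alpha> > -1"
  shows "(1 - r\<^sup>2) powr (\<alpha> + 1) * \<bar>(1 - r) powr (- \<alpha>) - 1\<bar> / (1 + r\<^sup>2) +
      integral {- (pi/2)..3*pi/2} (\<lambda>t. (1 - r\<^sup>2) powr (\<alpha> + 1) / (1 + r\<^sup>2) * (2 * r * \<bar>cos t\<bar>) *
        (1 + r\<^sup>2 - 2 * r * cos t) powr (- (1 + \<alpha>/2))) / (2 * pi) \<le> schwarz_bound r \<alpha>"
proof -
  define p where "p = 1 + \<alpha>/2"
  \<comment> \<open>Chosen so that 1 + r^2 - 2 r cos t = (1 + r^2)(1 - x cos t); then 1 - x^2 is the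
    square of (1 - r^2)/(1 + r^2).\<close>
  define x where "x = 2 * r / (1 + r\<^sup>2)"
  define C where "C = (if \<alpha> \<ge> 0 then 2 powr p else 2)"
  define F where "F = hypergeo_2F1 (1/2) (3/2 - p) (3/2) (x\<^sup>2)"
  have r2: "r\<^sup>2 < 1" using r by (simp add: power_less_one_iff abs_square_less_1)
  have q: "1 + r\<^sup>2 > 0" by (simp add: add_pos_nonneg)
  have x: "0 \<le> x" "x < 1"
  proof -
    show "0 \<le> x" using r q by (simp add: x_def)
    have "(1 - r)\<^sup>2 > 0" using r by simp
    then show "x < 1" using q by (simp add: x_def power2_eq_square algebra_simps)
  qed
  have C: "(1 - y) powr p + (1 + y) powr p \<le> C" if "0 \<le> y" "y < 1" for y
    using one_minus_plus_powr_le_two_powr[OF that, of p] one_minus_plus_powr_le_two[OF that, of p] \<alpha>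
    by (auto simp: C_def p_def)
  define K where "K = (1 - r\<^sup>2) powr (\<alpha> + 1) / (1 + r\<^sup>2) * (2 * r) * (1 + r\<^sup>2) powr (- p)"
  have "(1 - r\<^sup>2) powr (\<alpha> + 1) / (1 + r\<^sup>2) * (2 * r * \<bar>cos t\<bar>) * (1 + r\<^sup>2 - 2 * r * cos t) powr (- p)
      = K * (\<bar>cos t\<bar> * (1 - x * cos t) powr (- p))" for t
  proof -
    have *: "1 + r\<^sup>2 - 2 * r * cos t = (1 + r\<^sup>2) * (1 - x * cos t)"
      using q by (simp add: x_def field_simps)
    have "x * cos t \<le> x * 1" using x by (intro mult_left_mono) auto
    then have "1 - x * cos t \<ge> 0" using x by simp
    then show ?thesis using q unfolding * K_def by (simp add: powr_mult)
  qed
  then have "integral {- (pi/2)..3*pi/2} (\<lambda>t. (1 - r\<^sup>2) powr (\<alpha> + 1) / (1 + r\<^sup>2) * (2 * r * \<bar>cos t\<bar>) *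
        (1 + r\<^sup>2 - 2 * r * cos t) powr (- p)) =
      K * integral {- (pi/2)..3*pi/2} (\<lambda>t. \<bar>cos t\<bar> * (1 - x * cos t) powr (- p))"
    by simp
  also have "\<dots> \<le> K * (2 * C * (1 - x\<^sup>2) powr (1/2 - p) * F)"
    unfolding F_def using r q \<alpha>
    by (intro mult_left_mono integral_abs_cos_powr_le x C) (auto simp: K_def p_def)
  also have "\<dots> = 4 * r * C * (1 + r\<^sup>2) powr (\<alpha>/2 - 1) * F"
  proof -
    have "(1 + r\<^sup>2)\<^sup>2 - (2 * r)\<^sup>2 = (1 - r\<^sup>2)\<^sup>2" by (simp add: power2_eq_square algebra_simps)
    moreover have "1 - x\<^sup>2 = ((1 + r\<^sup>2)\<^sup>2 - (2 * r)\<^sup>2) / (1 + r\<^sup>2)\<^sup>2"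
      using q unfolding x_def power_divide by (simp add: diff_divide_distrib)
    ultimately have "1 - x\<^sup>2 = ((1 - r\<^sup>2) / (1 + r\<^sup>2))\<^sup>2"
      by (simp add: power_divide)
    then have "1 - x\<^sup>2 = ((1 - r\<^sup>2) / (1 + r\<^sup>2)) powr 2"
      using q r2 by simp
    then have "(1 - x\<^sup>2) powr (1/2 - p) = ((1 - r\<^sup>2) / (1 + r\<^sup>2)) powr (2 * (1/2 - p))"
      by (simp only: powr_powr)
    \<comment> \<open>Hence the factor (1 - r^2)^(\<alpha>+1) of the kernel cancels exactly, and the
      hypergeometric term keeps only powers of 1 + r^2.\<close>
    also have "2 * (1/2 - p) = - (\<alpha> + 1)" by (simp add: p_def)
    also have "((1 - r\<^sup>2) / (1 + r\<^sup>2)) powr (- (\<alpha> + 1)) = (1 + r\<^sup>2) powr (\<alpha> + 1) / (1 - r\<^sup>2) powr (\<alpha> + 1)"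
      using q r2 unfolding powr_minus_divide by (simp add: powr_divide)
    finally have "K * (1 - x\<^sup>2) powr (1/2 - p) = 2 * r * ((1 + r\<^sup>2) powr (- 1) * (1 + r\<^sup>2) powr (- p) * (1 + r\<^sup>2) powr (\<alpha> + 1))"
      using q r2 by (simp add: K_def powr_minus field_simps)
    also have "(1 + r\<^sup>2) powr (- 1) * (1 + r\<^sup>2) powr (- p) * (1 + r\<^sup>2) powr (\<alpha> + 1) = (1 + r\<^sup>2) powr (\<alpha>/2 - 1)"
      unfolding powr_add[symmetric] by (simp add: p_def)
    finally show ?thesis by (simp add: mult_ac)
  qed
  finally have "integral {- (pi/2)..3*pi/2} (\<lambda>t. (1 - r\<^sup>2) powr (\<alpha> + 1) / (1 + r\<^sup>2) * (2 * r * \<bar>cos t\<bar>) *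
        (1 + r\<^sup>2 - 2 * r * cos t) powr (- p)) / (2 * pi) \<le> 4 * r * C * (1 + r\<^sup>2) powr (\<alpha>/2 - 1) * F / (2 * pi)"
    by (rule divide_right_mono) simp
  also have "\<dots> = 2 * r * C * (1 + r\<^sup>2) powr (\<alpha>/2 - 1) * F / pi" by simp
  finally have "integral {- (pi/2)..3*pi/2} (\<lambda>t. (1 - r\<^sup>2) powr (\<alpha> + 1) / (1 + r\<^sup>2) * (2 * r * \<bar>cos t\<bar>) *
        (1 + r\<^sup>2 - 2 * r * cos t) powr (- p)) / (2 * pi) \<le> 2 * r * C * (1 + r\<^sup>2) powr (\<alpha>/2 - 1) * F / pi" .
  moreover have "2 * r * C * (1 + r\<^sup>2) powr (\<alpha>/2 - 1) * F / pi =
     (if \<alpha> \<ge> 0 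
      then 2 powr (2 + \<alpha> / 2) * r * (1 + r\<^sup>2) powr (\<alpha> / 2 - 1) / pi *
           hypergeo_2F1 (1/2) (1/2 - \<alpha>/2) (3/2) (4 * r\<^sup>2 / (1 + r\<^sup>2)\<^sup>2)
      else 4 * r / pi * (1 + r\<^sup>2) powr (\<alpha> / 2 - 1) *
           hypergeo_2F1 (1/2) (1/2 - \<alpha>/2) (3/2) (4 * r\<^sup>2 / (1 + r\<^sup>2)\<^sup>2))"
  proof -
    have "x\<^sup>2 = 4 * r\<^sup>2 / (1 + r\<^sup>2)\<^sup>2" by (simp add: x_def power_divide power_mult_distrib)
    moreover have "2 * 2 powr p = 2 powr (2 + \<alpha> / 2)"
      using powr_add[of "2::real" 1 p] by (simp add: p_def add.commute)
    ultimately show ?thesis by (auto simp: C_def F_def p_def)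
  qed
  ultimately show ?thesis unfolding schwarz_bound_def p_def[symmetric] by simp
qed

section \<open>The weighted Poisson kernel\<close>

text \<open>\<open>t ^ (k + 1) * ibeta \<alpha> k t\<close> is the incomplete beta function \<open>B(t; k + 1, \<alpha> + 1)\<close>.\<close>

definition ibeta :: "real \<Rightarrow> nat \<Rightarrow> real \<Rightarrow> real" where
  "ibeta \<alpha> k t = integral {0..1} (\<lambda>s. s ^ k * (1 - s * t) powr \<alpha>)"

section \<open>Bounds, recurrence and boundary limit of the incomplete beta weights\<close>

lemma one_minus_mult_pos:
  fixes s t :: real
  assumes "t \<in> {0..<1}" "s \<in> {0..1}"
  shows "0 < 1 - s * t"
  using assms mult_left_le_one_le[of t s] by (simp add: mult.commute)

lemma continuous_on_ibeta_integrand: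
  assumes "t \<in> {0..<1}"
  shows "continuous_on {0..1} (\<lambda>s::real. s ^ k * (1 - s * t) powr \<alpha>)"
  by (intro continuous_intros) (use one_minus_mult_pos[OF assms] in fastforce)

lemma has_integral_ibeta:
  assumes "t \<in> {0..<1}"
  shows "((\<lambda>s. s ^ k * (1 - s * t) powr \<alpha>) has_integral ibeta \<alpha> k t) {0..1}"
  unfolding ibeta_def
  by (intro integrable_integral integrable_continuous_real continuous_on_ibeta_integrand assms)

text \<open>For \<alpha> >= 0 the power is at most 1; for \<alpha> < 0 it increases with s and is
  largest at s = 1. The maximum is a majorant free of s for both signs.\<close>

lemma one_minus_mult_powr_le:
  fixes s t \<alpha> :: real
  assumes t: "t \<in> {0..<1}" and s: "s \<in> {0..1}"
  shows "(1 - s * t) powr \<alpha> \<le> max 1 ((1 - t) powr \<alpha>)"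
proof (cases "\<alpha> \<ge> 0")
  case True
  then have "(1 - s * t) powr \<alpha> \<le> 1"
    using one_minus_mult_pos[OF t s] t s by (intro powr_le1) auto
  then show ?thesis by simp
next
  case False
  have "s * t \<le> t" using t s by (simp add: mult_left_le_one_le)
  then have "(1 - s * t) powr \<alpha> \<le> (1 - t) powr \<alpha>"
    using False t by (intro powr_mono2') auto
  then show ?thesis by simp
qed

lemma ibeta_nonneg: "0 \<le> ibeta \<alpha> k t"
  \<comment> \<open>For arbitrary real t the integrand may fail to be integrable;
    \<open>integral\<close> then has the default value 0.\<close>
  unfolding ibeta_def by (cases "(\<lambda>s. s ^ k * (1 - s * t) powr \<alpha>) integrable_on {0..1}")
    (auto intro: integral_nonneg simp: not_integrable_integral)

lemma ibeta_le:
  assumes t: "t \<in> {0..<1}"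
  shows "ibeta \<alpha> k t \<le> max 1 ((1 - t) powr \<alpha>)"
proof -
  have "ibeta \<alpha> k t \<le> integral {0..1} (\<lambda>s::real. max 1 ((1 - t) powr \<alpha>))"
    unfolding ibeta_def
  proof (rule integral_le)
    show "(\<lambda>s. s ^ k * (1 - s * t) powr \<alpha>) integrable_on {0..1}"
      by (intro integrable_continuous_real continuous_on_ibeta_integrand t)
    fix s :: real assume s: "s \<in> {0..1}"
    have "s ^ k * (1 - s * t) powr \<alpha> \<le> 1 * max 1 ((1 - t) powr \<alpha>)"
      using s by (intro mult_mono one_minus_mult_powr_le[OF t s]) (auto simp: power_le_one)
    then show "s ^ k * (1 - s * t) powr \<alpha> \<le> max 1 ((1 - t) powr \<alpha>)" by simp
  qed (rule integrable_const_ivl)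
  then show ?thesis by simp
qed

lemma ibeta_0:
  assumes t: "t \<in> {0..<1}" and \<alpha>: "\<alpha> > -1"
  shows "(\<alpha> + 1) * t * ibeta \<alpha> 0 t = 1 - (1 - t) powr (\<alpha> + 1)"
proof -
  have "((\<lambda>s. (\<alpha> + 1) * t * (1 - s * t) powr \<alpha>) has_integral
      - ((1 - 1 * t) powr (\<alpha> + 1)) - (- ((1 - 0 * t) powr (\<alpha> + 1)))) {0..1}"
  proof (rule fundamental_theorem_of_calculus)
    fix s :: real assume s: "s \<in> {0..1}"
    show "((\<lambda>s. - ((1 - s * t) powr (\<alpha> + 1))) has_vector_derivative (\<alpha> + 1) * t * (1 - s * t) powr \<alpha>) (at s within {0..1})"
      unfolding has_real_derivative_iff_has_vector_derivative[symmetric]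
      using one_minus_mult_pos[OF t s] by (auto intro!: derivative_eq_intros)
  qed simp
  moreover have "((\<lambda>s. (\<alpha> + 1) * t * (s ^ 0 * (1 - s * t) powr \<alpha>)) has_integral (\<alpha> + 1) * t * ibeta \<alpha> 0 t) {0..1}"
    by (intro has_integral_mult_right has_integral_ibeta t)
  ultimately have "(\<alpha> + 1) * t * ibeta \<alpha> 0 t = - ((1 - 1 * t) powr (\<alpha> + 1)) - (- ((1 - 0 * t) powr (\<alpha> + 1)))"
    unfolding power_0 mult_1 by (rule has_integral_unique[rotated])
  then show ?thesis by simp
qed

text \<open>Integrate the derivative of s^(k+1) (1 - s t)^(\<alpha>+1) over [0, 1] and write one
  factor (1 - s t)^(\<alpha>+1) as (1 - s t) (1 - s t)^\<alpha>. This is the classical recurrence of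
  the incomplete beta function with its boundary term.\<close>

lemma ibeta_Suc:
  assumes t: "t \<in> {0..<1}" and \<alpha>: "\<alpha> > -1"
  shows "(real k + \<alpha> + 2) * t * ibeta \<alpha> (Suc k) t = (real k + 1) * ibeta \<alpha> k t - (1 - t) powr (\<alpha> + 1)"
proof -
  define g where "g j s = s ^ j * (1 - s * t) powr \<alpha>" for j s
  have g: "(g j has_integral ibeta \<alpha> j t) {0..1}" for j
    unfolding g_def by (rule has_integral_ibeta[OF t])
  have "((\<lambda>s. (real k + 1) * g k s - (real k + \<alpha> + 2) * t * g (Suc k) s) has_integral
      (1 ^ Suc k * (1 - 1 * t) powr (\<alpha> + 1)) - (0 ^ Suc k * (1 - 0 * t) powr (\<alpha> + 1))) {0..1}"
  proof (rule fundamental_theorem_of_calculus)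
    fix s :: real assume s: "s \<in> {0..1}"
    define y where "y = 1 - s * t"
    have y: "y > 0" using one_minus_mult_pos[OF t s] by (simp add: y_def)
    have D: "((\<lambda>s. s ^ Suc k * (1 - s * t) powr (\<alpha> + 1)) has_real_derivative
       (real k + 1) * s ^ k * y powr (\<alpha> + 1) - (\<alpha> + 1) * t * s ^ Suc k * y powr \<alpha>) (at s within {0..1})"
    proof -
      have "((\<lambda>s. s ^ Suc k) has_real_derivative (real k + 1) * s ^ k) (at s within {0..1})"
        using DERIV_pow[of "Suc k" s "{0..1}"] by (simp add: add.commute)
      moreover have "((\<lambda>s. (1 - s * t) powr (\<alpha> + 1)) has_real_derivative - ((\<alpha> + 1) * t * y powr \<alpha>)) (at s within {0..1})"
        using y unfolding y_def by (auto intro!: derivative_eq_intros)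
      ultimately show ?thesis
        by (rule DERIV_cong[OF DERIV_mult]) (simp add: y_def algebra_simps)
    qed
    have e: "y powr (\<alpha> + 1) = (1 - s * t) * y powr \<alpha>"
      using y by (simp add: powr_add y_def)
    have val: "(real k + 1) * s ^ k * ((1 - s * t) * y powr \<alpha>) - (\<alpha> + 1) * t * s ^ Suc k * y powr \<alpha> =
       (real k + 1) * g k s - (real k + \<alpha> + 2) * t * g (Suc k) s"
      unfolding g_def y_def by (simp add: algebra_simps)
    have "((\<lambda>s. s ^ Suc k * (1 - s * t) powr (\<alpha> + 1)) has_real_derivative
       (real k + 1) * g k s - (real k + \<alpha> + 2) * t * g (Suc k) s) (at s within {0..1})"
      by (rule DERIV_cong[OF D]) (simp only: e val)
    then show "((\<lambda>s. s ^ Suc k * (1 - s * t) powr (\<alpha> + 1)) has_vector_derivative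
       (real k + 1) * g k s - (real k + \<alpha> + 2) * t * g (Suc k) s) (at s within {0..1})"
      unfolding has_real_derivative_iff_has_vector_derivative .
  qed simp
  moreover have "((\<lambda>s. (real k + 1) * g k s - (real k + \<alpha> + 2) * t * g (Suc k) s) has_integral
      (real k + 1) * ibeta \<alpha> k t - (real k + \<alpha> + 2) * t * ibeta \<alpha> (Suc k) t) {0..1}"
    by (intro has_integral_diff has_integral_mult_right g)
  ultimately have "(real k + 1) * ibeta \<alpha> k t - (real k + \<alpha> + 2) * t * ibeta \<alpha> (Suc k) t =
      (1 ^ Suc k * (1 - 1 * t) powr (\<alpha> + 1)) - (0 ^ Suc k * (1 - 0 * t) powr (\<alpha> + 1))"
    by (rule has_integral_unique[rotated])
  then show ?thesis by simp
qed

text \<open>At \<open>t = 1\<close> the integral becomes the beta value \<open>B(k + 1, \<alpha> + 1)\<close>.\<close>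

lemma ibeta_tendsto:
  assumes \<alpha>: "\<alpha> > -1"
  shows "(ibeta \<alpha> k \<longlongrightarrow> fact k / pochhammer (\<alpha> + 1) (Suc k)) (at_left 1)"
\<comment> \<open>The limit is carried along the recurrence instead of being moved under the
  integral, whose integrand is singular at s = t = 1 when \<alpha> < 0.\<close>
proof (induction k)
  have ev: "\<forall>\<^sub>F t in at_left (1::real). t \<in> {0<..<1}"
    using eventually_at_left_real[of 0 1] by simp
  \<comment> \<open>The boundary term of the recurrence dies out precisely because \<alpha> + 1 >
    0.\<close>
  have lim: "((\<lambda>t. (1 - t) powr (\<alpha> + 1)) \<longlongrightarrow> 0) (at_left (1::real))"
  proof -
    have "((\<lambda>t. (1 - t) powr (\<alpha> + 1)) \<longlongrightarrow> 0 powr (\<alpha> + 1)) (at_left (1::real))"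
      by (rule tendsto_powr'[OF _ tendsto_const])
        (use \<alpha> in \<open>auto intro!: tendsto_eq_intros eventually_mono[OF ev]\<close>)
    then show ?thesis by simp
  qed
  {
    case 0
    have "((\<lambda>t. (1 - (1 - t) powr (\<alpha> + 1)) / ((\<alpha> + 1) * t)) \<longlongrightarrow> (1 - 0) / ((\<alpha> + 1) * 1)) (at_left 1)"
      using \<alpha> by (intro tendsto_intros lim) auto
    moreover have "\<forall>\<^sub>F t in at_left 1. (1 - (1 - t) powr (\<alpha> + 1)) / ((\<alpha> + 1) * t) = ibeta \<alpha> 0 t"
      using ev
    proof eventually_elim
      case (elim t)
      then have "(\<alpha> + 1) * t \<noteq> 0" using \<alpha> by auto
      then show ?case using ibeta_0[of t \<alpha>] \<alpha> elim by (simp add: divide_eq_eq mult_ac)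
    qed
    ultimately show ?case by (simp add: tendsto_cong)
  next
    case (Suc k)
    have "((\<lambda>t. ((real k + 1) * ibeta \<alpha> k t - (1 - t) powr (\<alpha> + 1)) / ((real k + \<alpha> + 2) * t)) \<longlongrightarrow>
        ((real k + 1) * (fact k / pochhammer (\<alpha> + 1) (Suc k)) - 0) / ((real k + \<alpha> + 2) * 1)) (at_left 1)"
      using \<alpha> by (intro tendsto_intros lim Suc) auto
    moreover have "\<forall>\<^sub>F t in at_left 1. ((real k + 1) * ibeta \<alpha> k t - (1 - t) powr (\<alpha> + 1)) / ((real k + \<alpha> + 2) * t) = ibeta \<alpha> (Suc k) t"
      using ev
    proof eventually_elim
      case (elim t)
      have "real k + \<alpha> + 2 \<noteq> 0" using \<alpha> by linarith
      then have "(real k + \<alpha> + 2) * t \<noteq> 0" using elim by auto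
      moreover have "t \<in> {0..<1}" using elim by simp
      ultimately show ?case
        unfolding ibeta_Suc[OF \<open>t \<in> {0..<1}\<close> \<alpha>, symmetric] by (intro nonzero_mult_div_cancel_left)
    qed
    moreover have "((real k + 1) * (fact k / pochhammer (\<alpha> + 1) (Suc k)) - 0) / ((real k + \<alpha> + 2) * 1) =
        fact (Suc k) / pochhammer (\<alpha> + 1) (Suc (Suc k))"
      by (simp add: pochhammer_Suc[of _ "Suc k"] algebra_simps)
    ultimately show ?case using tendsto_cong by force
  }
qed

text \<open>The factor is the reciprocal of B(k+1, \<alpha>+1), so this is the regularized
  incomplete beta function divided by t^(k+1), and it tends to 1 as t tends to 1 from below.\<close>

definition kernel_coeff :: "real \<Rightarrow> nat \<Rightarrow> real \<Rightarrow> real" where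
  "kernel_coeff \<alpha> k t = ibeta \<alpha> k t * (pochhammer (\<alpha> + 1) (Suc k) / fact k)"

text \<open>For \<alpha> = 0 this is the classical Poisson kernel (1 - |z|^2)/|1 - z|^2; the
  argument stands for a point of the disc times the conjugate of a boundary point. The principal
  power is harmless because 1 - cnj z has positive real part in the disc.\<close>

definition poisson_kernel :: "real \<Rightarrow> complex \<Rightarrow> complex" where
  "poisson_kernel \<alpha> z =
     of_real ((1 - (cmod z)\<^sup>2) powr (\<alpha> + 1)) / ((1 - z) * (1 - cnj z) powr of_real (\<alpha> + 1))"

lemma kernel_coeff_nonneg: "\<alpha> > -1 \<Longrightarrow> 0 \<le> kernel_coeff \<alpha> k t"
  unfolding kernel_coeff_def by (intro mult_nonneg_nonneg ibeta_nonneg divide_nonneg_nonneg less_imp_le[OF pochhammer_pos]) auto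

lemma summable_kernel_coeff:
  assumes \<alpha>: "\<alpha> > -1" and t: "t \<in> {0..<1}" and y: "0 \<le> y" "y < 1"
  shows "summable (\<lambda>k. kernel_coeff \<alpha> k t * y ^ Suc k)"
proof (rule summable_comparison_test)
  define B where "B = max 1 ((1 - t) powr \<alpha>)"
  show "summable (\<lambda>k. B * (\<alpha> + 1) * y * (\<bar>pochhammer (\<alpha> + 2) k / fact k\<bar> * y ^ k))"
    by (intro summable_mult summable_abs_binomial_series y)
  have p: "pochhammer (\<alpha> + 2) k \<ge> 0" for k using \<alpha> by (intro less_imp_le pochhammer_pos) auto
  have "norm (kernel_coeff \<alpha> k t * y ^ Suc k) = ibeta \<alpha> k t * ((\<alpha> + 1) * y * (\<bar>pochhammer (\<alpha> + 2) k / fact k\<bar> * y ^ k))" for k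
    using \<alpha> y p[of k] ibeta_nonneg[of \<alpha> k t]
    by (simp add: kernel_coeff_def abs_mult pochhammer_rec add.assoc)
  also have "\<dots> k \<le> B * ((\<alpha> + 1) * y * (\<bar>pochhammer (\<alpha> + 2) k / fact k\<bar> * y ^ k))" for k
    unfolding B_def by (intro mult_right_mono ibeta_le t) (use \<alpha> y in auto)
  finally show "\<exists>N. \<forall>k\<ge>N. norm (kernel_coeff \<alpha> k t * y ^ Suc k) \<le> B * (\<alpha> + 1) * y * (\<bar>pochhammer (\<alpha> + 2) k / fact k\<bar> * y ^ k)"
    by (simp add: mult.assoc)
qed

text \<open>The conjugate terms are summed under the integral of \<open>ibeta\<close>. Splitting off
  \<alpha> + 1 from the Pochhammer symbol leaves a binomial series of exponent -(\<alpha>+2), and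
  the sum, as a function of s, has an elementary antiderivative. Its value at s = 1 is the kernel;
  its value at s = 0 is 1/(1 - z), which the geometric series of the z^n restores.\<close>

lemma poisson_kernel_sums:
  assumes \<alpha>: "\<alpha> > -1" and z: "norm z < 1"
  shows "(\<lambda>n. z ^ n + of_real (kernel_coeff \<alpha> n ((norm z)\<^sup>2)) * cnj z ^ Suc n) sums poisson_kernel \<alpha> z"
proof -
  define t where "t = (norm z)\<^sup>2"
  define w where "w = cnj z"
  have t: "t \<in> {0..<1}" using z by (simp add: t_def power_less_one_iff abs_square_less_1)
  have w: "norm w < 1" using z by (simp add: w_def)
  have zw: "z * w = of_real t" by (simp add: t_def w_def complex_norm_square[symmetric])
  define u where "u n s = of_real (s ^ n * (1 - s * t) powr \<alpha> * (pochhammer (\<alpha> + 1) (Suc n) / fact n)) * w ^ Suc n" for n and s :: real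
  define B where "B = max 1 ((1 - t) powr \<alpha>)"
  have p: "pochhammer (\<alpha> + 2) k \<ge> 0" for k using \<alpha> by (intro less_imp_le pochhammer_pos) auto
  have sw: "norm (of_real s * w) < 1" if "s \<in> {0..1}" for s :: real
    using that w mult_left_le_one_le[of "norm w" s] by (simp add: norm_mult)
  have np: "1 - of_real s * w \<notin> \<real>\<^sub>\<le>\<^sub>0" if "s \<in> {0..1}" for s :: real
    using sw[OF that] by (smt (verit) complex_Re_le_cmod complex_nonpos_Reals_iff minus_complex.simps(1) one_complex.simps(1))
  have sums_u: "(\<lambda>n. u n s) sums (of_real ((1 - s * t) powr \<alpha>) * of_real (\<alpha> + 1) * w * (1 - of_real s * w) powr of_real (- (\<alpha> + 2)))"
    if s: "s \<in> {0..1}" for s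
  proof -
    have "u n s = (of_real ((1 - s * t) powr \<alpha>) * of_real (\<alpha> + 1) * w) *
        (of_real (pochhammer (\<alpha> + 2) n / fact n) * (of_real s * w) ^ n)" for n
      unfolding u_def pochhammer_rec by (simp add: power_mult_distrib add.assoc mult_ac)
    then show ?thesis
      using sums_mult[OF binomial_series_complex[OF sw[OF s], of "\<alpha> + 2"]] by simp
  qed
  have "(\<lambda>n. integral {0..1} (u n)) sums integral {0..1} (\<lambda>s. \<Sum>n. u n s)"
  proof (rule sums_integral_Weierstrass)
    show "continuous_on {0..1} (u n)" for n
      unfolding u_def by (intro continuous_intros continuous_on_ibeta_integrand t)
    show "summable (\<lambda>k. B * (\<alpha> + 1) * norm w * (\<bar>pochhammer (\<alpha> + 2) k / fact k\<bar> * norm w ^ k))"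
      using w by (intro summable_mult summable_abs_binomial_series) auto
    fix n and s :: real assume s: "s \<in> {0..1}"
    have "norm (u n s) = (s ^ n * (1 - s * t) powr \<alpha>) * ((\<alpha> + 1) * norm w * (\<bar>pochhammer (\<alpha> + 2) n / fact n\<bar> * norm w ^ n))"
      unfolding u_def norm_mult norm_of_real norm_power pochhammer_rec using \<alpha> s p[of n]
      by (simp add: abs_mult add.assoc)
    also have "\<dots> \<le> (1 * B) * ((\<alpha> + 1) * norm w * (\<bar>pochhammer (\<alpha> + 2) n / fact n\<bar> * norm w ^ n))"
      unfolding B_def using s \<alpha> by (intro mult_right_mono mult_mono one_minus_mult_powr_le[OF t s]) (auto simp: power_le_one)
    finally show "norm (u n s) \<le> B * (\<alpha> + 1) * norm w * (\<bar>pochhammer (\<alpha> + 2) n / fact n\<bar> * norm w ^ n)"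
      by (simp add: mult.assoc)
  qed
  moreover have "integral {0..1} (u n) = of_real (kernel_coeff \<alpha> n t) * w ^ Suc n" for n
  proof -
    have "((\<lambda>s. s ^ n * (1 - s * t) powr \<alpha>) has_integral ibeta \<alpha> n t) {0..1}"
      by (rule has_integral_ibeta[OF t])
    then have "((\<lambda>s. of_real (s ^ n * (1 - s * t) powr \<alpha> * (pochhammer (\<alpha> + 1) (Suc n) / fact n)) * w ^ Suc n) has_integral
       of_real (ibeta \<alpha> n t * (pochhammer (\<alpha> + 1) (Suc n) / fact n)) * w ^ Suc n) {0..1}"
      by (intro has_integral_mult_left has_integral_of_real)
    then show ?thesis unfolding u_def[abs_def] kernel_coeff_def by (rule integral_unique)
  qed
  moreover have "integral {0..1} (\<lambda>s. \<Sum>n. u n s) = poisson_kernel \<alpha> z - 1 / (1 - z)"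
  proof -
    \<comment> \<open>Up to 1/(1 - z) this is the (\<alpha>+1)-th power of the Moebius quotient (1 -
      s t)/(1 - s w), whose derivative in s is (w - t)/(1 - s w)^2.\<close>
    define \<Theta> where "\<Theta> s = of_real ((1 - s * t) powr (\<alpha> + 1)) * (1 - of_real s * w) powr of_real (- (\<alpha> + 1)) / (1 - z)" for s :: real
    have z1: "1 - z \<noteq> 0" using z by auto
    have "((\<lambda>s. \<Sum>n. u n s) has_integral \<Theta> 1 - \<Theta> 0) {0..1}"
    proof (rule fundamental_theorem_of_calculus)
      fix s :: real assume s: "s \<in> {0..1}"
      define y where "y = 1 - s * t"
      define v where "v = 1 - of_real s * w"
      define X where "X = complex_of_real (y powr \<alpha>)"
      define Y where "Y = v powr of_real (- (\<alpha> + 2))"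
      have y: "y > 0" using one_minus_mult_pos[OF t s] by (simp add: y_def)
      have v0: "v \<noteq> 0" using np[OF s] unfolding v_def[symmetric] by auto
      have d1: "((\<lambda>s. complex_of_real ((1 - s * t) powr (\<alpha> + 1))) has_vector_derivative of_real (- (\<alpha> + 1) * t * y powr \<alpha>)) (at s within {0..1})"
        unfolding y_def
        by (rule has_vector_derivative_of_real)
          (use y in \<open>auto intro!: derivative_eq_intros simp: has_real_derivative_iff_has_vector_derivative[symmetric] y_def algebra_simps\<close>)
      have d2: "((\<lambda>s. (1 - of_real s * w) powr of_real (- (\<alpha> + 1))) has_vector_derivative
          of_real (- (\<alpha> + 1)) * Y * (- w)) (at s within {0..1})"
      proof (rule has_vector_derivative_real_field)
        have "((\<lambda>\<zeta>. (1 - \<zeta> * w) powr of_real (- (\<alpha> + 1))) has_field_derivative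
            of_real (- (\<alpha> + 1)) * v powr (of_real (- (\<alpha> + 1)) - 1) * (- w)) (at (of_real s))"
          unfolding v_def using np[OF s] by (auto intro!: derivative_eq_intros)
        moreover have "of_real (- (\<alpha> + 1)) - 1 = complex_of_real (- (\<alpha> + 2))" by simp
        ultimately show "((\<lambda>\<zeta>. (1 - \<zeta> * w) powr of_real (- (\<alpha> + 1))) has_field_derivative
            of_real (- (\<alpha> + 1)) * Y * (- w)) (at (of_real s))"
          unfolding Y_def by metis
      qed
      have e1: "complex_of_real (y powr (\<alpha> + 1)) = X * of_real y"
        using y by (simp add: X_def powr_add)
      have e3: "complex_of_real (- (\<alpha> + 1) * t * y powr \<alpha>) = - of_real (\<alpha> + 1) * of_real t * X"
        by (simp add: X_def)
      have e2: "v powr of_real (- (\<alpha> + 1)) = Y * v"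
      proof -
        have "complex_of_real (- (\<alpha> + 1)) = of_real (- (\<alpha> + 2)) + 1" by simp
        then show ?thesis using v0 unfolding Y_def by (simp only: powr_add powr_to_1)
      qed
      have "(\<Theta> has_vector_derivative (of_real (y powr (\<alpha> + 1)) * (of_real (- (\<alpha> + 1)) * Y * (- w)) +
          of_real (- (\<alpha> + 1) * t * y powr \<alpha>) * v powr of_real (- (\<alpha> + 1))) / (1 - z)) (at s within {0..1})"
        unfolding \<Theta>_def divide_inverse
        by (intro has_vector_derivative_mult_left has_vector_derivative_mult[OF d1 d2, folded y_def v_def])
      also have "(of_real (y powr (\<alpha> + 1)) * (of_real (- (\<alpha> + 1)) * Y * (- w)) +
          of_real (- (\<alpha> + 1) * t * y powr \<alpha>) * v powr of_real (- (\<alpha> + 1))) =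
          X * of_real (\<alpha> + 1) * Y * (w - of_real t)"
        unfolding e1 e2 e3 by (simp add: y_def v_def algebra_simps)
      \<comment> \<open>Since t = z w, the denominator 1 - z of the antiderivative cancels.\<close>
      also have "w - of_real t = w * (1 - z)" unfolding zw[symmetric] by (simp add: algebra_simps)
      also have "X * of_real (\<alpha> + 1) * Y * (w * (1 - z)) / (1 - z) = (\<Sum>n. u n s)"
        using sums_unique[OF sums_u[OF s]] z1 by (simp add: X_def Y_def y_def v_def mult_ac)
      finally show "(\<Theta> has_vector_derivative (\<Sum>n. u n s)) (at s within {0..1})" .
    qed simp
    moreover have "\<Theta> 1 = poisson_kernel \<alpha> z" "\<Theta> 0 = 1 / (1 - z)"
      unfolding \<Theta>_def poisson_kernel_def of_real_minus powr_minus t_def w_def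
      by (simp_all add: divide_inverse mult_ac)
    ultimately show ?thesis by (simp add: integral_unique)
  qed
  ultimately have "(\<lambda>n. of_real (kernel_coeff \<alpha> n t) * w ^ Suc n) sums (poisson_kernel \<alpha> z - 1 / (1 - z))"
    by simp
  from sums_add[OF geometric_sums[OF z] this] show ?thesis by (simp add: t_def w_def)
qed

text \<open>Adding and subtracting (A/Q) V, where A/Q is the constant, splits the difference into
  (A/Q)(V - 1) and (A/Q) V (Q - D)/D with Q - D = 2 Re z. The sign property of the binomial
  coefficients bounds V - 1; the second modulus is computed exactly.\<close>

lemma norm_poisson_kernel_diff_le:
  assumes \<alpha>: "\<alpha> > -1" and r: "norm z = r" "r < 1"
  shows "norm (poisson_kernel \<alpha> z - of_real ((1 - r\<^sup>2) powr (\<alpha> + 1) / (1 + r\<^sup>2)))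
    \<le> (1 - r\<^sup>2) powr (\<alpha> + 1) * \<bar>(1 - r) powr (- \<alpha>) - 1\<bar> / (1 + r\<^sup>2) +
      (1 - r\<^sup>2) powr (\<alpha> + 1) / (1 + r\<^sup>2) * (2 * \<bar>Re z\<bar>) * (1 + r\<^sup>2 - 2 * Re z) powr (- (1 + \<alpha>/2))"
proof -
  define A where "A = (1 - r\<^sup>2) powr (\<alpha> + 1)"
  define Q where "Q = 1 + r\<^sup>2"
  define D where "D = (cmod (1 - z))\<^sup>2"
  define V where "V = (1 - cnj z) powr of_real (- \<alpha>)"
  have z1: "1 - z \<noteq> 0" "1 - cnj z \<noteq> 0" using r by (auto simp: complex_cnj_one_iff dest: arg_cong[of _ _ cnj])
  have D: "D > 0" using z1 by (simp add: D_def)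
  have D': "(1 - z) * (1 - cnj z) = of_real D"
    unfolding D_def complex_norm_square by simp
  have Dr: "D = Q - 2 * Re z"
    unfolding D_def Q_def r(1)[symmetric] cmod_power2 by (simp add: power2_eq_square algebra_simps)
  have Q: "Q > 0" by (simp add: Q_def add_pos_nonneg)
  have AQ: "0 \<le> A / Q" using Q by (simp add: A_def)
  have nV: "norm V = D powr (- \<alpha> / 2)"
  proof -
    have "norm V = cmod (1 - cnj z) powr (- \<alpha>)"
      unfolding V_def by (subst norm_powr_real_powr') auto
    also have "cmod (1 - cnj z) = cmod (1 - z)"
      using complex_mod_cnj[of "1 - z"] by simp
    also have "\<dots> = D powr (1/2)" by (simp add: D_def powr_half_sqrt)
    finally show ?thesis by (simp add: powr_powr)
  qed
  have "(1 - cnj z) powr of_real (\<alpha> + 1) = (1 - cnj z) / V"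
    using z1(2) unfolding V_def of_real_add of_real_minus powr_add powr_minus
    by (simp add: divide_inverse)
  then have P: "poisson_kernel \<alpha> z = of_real A * V / of_real D"
    using z1 by (simp add: poisson_kernel_def A_def r(1) flip: D')
  have "poisson_kernel \<alpha> z - of_real (A / Q) = of_real (A / Q) * (V - 1) + of_real (A / Q * (2 * Re z) / D) * V"
  proof -
    have "of_real A * V / of_real D - of_real (A / Q) = of_real (A / Q) * (V - 1) + of_real (A / Q * (Q - D) / D) * V"
      using Q D by (simp add: field_simps)
    then show ?thesis by (simp add: P Dr)
  qed
  also have "norm \<dots> \<le> A / Q * norm (V - 1) + A / Q * (2 * \<bar>Re z\<bar>) / D * norm V"
    by (rule norm_triangle_le) (use Q D in \<open>simp add: norm_mult norm_divide A_def abs_mult\<close>)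
  also have "\<dots> \<le> A / Q * \<bar>(1 - r) powr (- \<alpha>) - 1\<bar> + A / Q * (2 * \<bar>Re z\<bar>) * D powr (- (1 + \<alpha>/2))"
  proof (rule add_mono)
    have "norm (V - 1) \<le> \<bar>(1 - r) powr (- \<alpha>) - 1\<bar>"
      using norm_one_minus_powr_minus_one_le[OF \<alpha>, of "cnj z"] r by (simp add: V_def)
    then show "A / Q * norm (V - 1) \<le> A / Q * \<bar>(1 - r) powr (- \<alpha>) - 1\<bar>"
      by (rule mult_left_mono[OF _ AQ])
    have "D powr (- (1 + \<alpha>/2)) = D powr (- \<alpha> / 2) / D"
    proof -
      have "- (1 + \<alpha>/2) = - \<alpha> / 2 - 1" by simp
      then show ?thesis using D by (simp only: powr_diff powr_one less_imp_le)
    qed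
    then show "A / Q * (2 * \<bar>Re z\<bar>) / D * norm V \<le> A / Q * (2 * \<bar>Re z\<bar>) * D powr (- (1 + \<alpha>/2))"
      by (simp add: nV)
  qed
  finally show ?thesis
    unfolding A_def Q_def Dr by (simp only: times_divide_eq_left)
qed

section \<open>Fourier coefficients and pairing on circles\<close>

lemma integral_cis_int:
  "((\<lambda>t. cis (of_int m * t)) has_integral (if m = 0 then of_real (2 * pi) else 0)) {- (pi/2)..3*pi/2}"
proof (cases "m = 0")
  case True
  have "((\<lambda>t::real. 1::complex) has_integral of_real (3*pi/2 - (- (pi/2)))) {- (pi/2)..3*pi/2}"
    using has_integral_const_real[of "1::complex" "- (pi/2)" "3*pi/2"] by (simp add: scaleR_conv_of_real)
  then show ?thesis using True by simp
next
  case False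
  have "((\<lambda>t. cis (of_int m * t)) has_integral
     cis (of_int m * (3*pi/2)) / (\<i> * of_int m) - cis (of_int m * (- (pi/2))) / (\<i> * of_int m)) {- (pi/2)..3*pi/2}"
  proof (rule fundamental_theorem_of_calculus)
    fix t :: real
    have "((\<lambda>z. exp (\<i> * (of_int m * z)) / (\<i> * of_int m)) has_field_derivative exp (\<i> * (of_int m * of_real t))) (at (of_real t))"
      using False by (auto intro!: derivative_eq_intros simp: mult_ac)
    from has_vector_derivative_real_field[OF this, of "{- (pi/2)..3*pi/2}"]
    show "((\<lambda>t. cis (of_int m * t) / (\<i> * of_int m)) has_vector_derivative cis (of_int m * t)) (at t within {- (pi/2)..3*pi/2})"
      by (simp add: cis_conv_exp)
  qed simp
  moreover have "cis (of_int m * (3*pi/2)) = cis (of_int m * (- (pi/2)))"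
  proof -
    have "of_int m * (3*pi/2) = of_int m * (- (pi/2)) + 2 * pi * of_int m" by (simp add: field_simps)
    then show ?thesis by (simp only: cis_mult[symmetric] cis_multiple_2pi Ints_of_int mult_1_right)
  qed
  ultimately show ?thesis using False by simp
qed

text \<open>Absolute summability permits termwise integration, and orthogonality then isolates one
  term. The frequencies of the \<open>d\<close> terms start at -1, hence never meet those of the
  \<open>c\<close> terms, which start at 0.\<close>

lemma has_integral_cis_series:
  fixes c d :: "nat \<Rightarrow> complex"
  assumes c: "summable (\<lambda>n. norm (c n))" and d: "summable (\<lambda>n. norm (d n))"
    and g: "\<And>t. (\<lambda>n. c n * cis (real n * t) + d n * cis (- (real (Suc n) * t))) sums g t"
  shows "integral {- (pi/2)..3*pi/2} (\<lambda>t. g t * cis (- (real k * t))) = of_real (2 * pi) * c k"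
    and "integral {- (pi/2)..3*pi/2} (\<lambda>t. g t * cis (real (Suc k) * t)) = of_real (2 * pi) * d k"
proof -
  let ?J = "{- (pi/2)..3*pi/2}"
  define e :: "int \<Rightarrow> complex" where "e m = (if m = 0 then of_real (2 * pi) else 0)" for m
  have gen: "(\<lambda>n. c n * e (int n + m) + d n * e (m - int (Suc n))) sums integral ?J (\<lambda>t. g t * cis (of_int m * t))" for m
  proof -
    define u where "u n t = (c n * cis (real n * t) + d n * cis (- (real (Suc n) * t))) * cis (of_int m * t)" for n t
    have u: "u n t = c n * cis (of_int (int n + m) * t) + d n * cis (of_int (m - int (Suc n)) * t)" for n t
      by (simp add: u_def distrib_right mult.assoc cis_mult algebra_simps)
    have "(u n has_integral c n * e (int n + m) + d n * e (m - int (Suc n))) ?J" for n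
      unfolding u[abs_def] e_def
      by (intro has_integral_add has_integral_mult_right integral_cis_int)
    then have iu: "integral ?J (u n) = c n * e (int n + m) + d n * e (m - int (Suc n))" for n
      by (rule integral_unique)
    have "(\<lambda>n. integral ?J (u n)) sums integral ?J (\<lambda>t. \<Sum>n. u n t)"
    proof (rule sums_integral_Weierstrass)
      show "continuous_on ?J (u n)" for n
        unfolding u_def by (intro continuous_intros continuous_on_cis)
      show "norm (u n t) \<le> norm (c n) + norm (d n)" for n t
        unfolding u by (rule norm_triangle_le) (simp add: norm_mult)
      show "summable (\<lambda>n. norm (c n) + norm (d n))" by (intro summable_add c d)
    qed
    moreover have "(\<Sum>n. u n t) = g t * cis (of_int m * t)" for t
      unfolding u_def using sums_unique[OF sums_mult2[OF g]] by simp
    ultimately show ?thesis unfolding iu by simp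
  qed
  have "(\<lambda>n. c n * e (int n + - int k) + d n * e (- int k - int (Suc n))) = (\<lambda>n. if n = k then of_real (2 * pi) * c k else 0)"
    by (auto simp: e_def fun_eq_iff)
  then have "(\<lambda>n. if n = k then of_real (2 * pi) * c k else 0) sums integral ?J (\<lambda>t. g t * cis (of_int (- int k) * t))"
    using gen[of "- int k"] by simp
  then show "integral ?J (\<lambda>t. g t * cis (- (real k * t))) = of_real (2 * pi) * c k"
    using sums_unique2[OF sums_single] by fastforce
  have "(\<lambda>n. c n * e (int n + int (Suc k)) + d n * e (int (Suc k) - int (Suc n))) = (\<lambda>n. if n = k then of_real (2 * pi) * d k else 0)"
    by (auto simp: e_def fun_eq_iff)
  then have "(\<lambda>n. if n = k then of_real (2 * pi) * d k else 0) sums integral ?J (\<lambda>t. g t * cis (of_int (int (Suc k)) * t))"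
    using gen[of "int (Suc k)"] by simp
  then show "integral ?J (\<lambda>t. g t * cis (real (Suc k) * t)) = of_real (2 * pi) * d k"
    using sums_unique2[OF sums_single] by fastforce
qed

text \<open>
  Pairing \<open>f\<close> on the circle of radius \<open>\<rho>\<close> with the partial sums of the kernel series and letting
  first \<open>\<rho>\<close> tend to 1 and then the order of the partial sum tend to infinity replaces
  the boundary function by the bound on \<open>f\<close>.
\<close>

lemma series_representation_bound:
  fixes a b :: "nat \<Rightarrow> complex" and f :: "complex \<Rightarrow> complex"
  assumes \<alpha>: "\<alpha> > -1" and r: "0 \<le> r" "r < 1"
    and a: "\<And>\<rho>. 0 \<le> \<rho> \<Longrightarrow> \<rho> < 1 \<Longrightarrow> summable (\<lambda>n. norm (a n) * \<rho> ^ n)"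
    and b: "\<And>\<rho>. 0 \<le> \<rho> \<Longrightarrow> \<rho> < 1 \<Longrightarrow> summable (\<lambda>n. norm (b n) * \<rho> ^ n)"
    and cont: "continuous_on (ball 0 1) f"
    and bound: "\<And>z. norm z < 1 \<Longrightarrow> norm (f z) \<le> 1"
    and f: "\<And>z. norm z < 1 \<Longrightarrow>
      (\<lambda>n. a n * z ^ n + b n * of_real (ibeta \<alpha> n ((norm z)\<^sup>2)) * cnj z ^ Suc n) sums f z"
  shows "norm (f (of_real r) - of_real ((1 - r\<^sup>2) powr (\<alpha> + 1) / (1 + r\<^sup>2)) * f 0) \<le> schwarz_bound r \<alpha>"
proof -
  let ?J = "{- (pi/2)..3*pi/2}"
  define c where "c = (1 - r\<^sup>2) powr (\<alpha> + 1) / (1 + r\<^sup>2)"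
  define K where "K n = kernel_coeff \<alpha> n (r\<^sup>2)" for n
  define u where "u n t = of_real (r ^ n) * cis (- (real n * t)) + of_real (K n * r ^ Suc n) * cis (real (Suc n) * t)" for n t
  define q where "q N t = (\<Sum>n<N. u n t) - of_real c" for N t
  \<comment> \<open>By orthogonality this is 1/(2 pi) times the integral of f(\<rho> cis t) against
    \<open>q N\<close>: each coefficient of f on the circle meets the kernel coefficient of opposite
    frequency.\<close>
  define S where "S N \<rho> = (\<Sum>n<N. of_real (r ^ n) * (a n * of_real (\<rho> ^ n)) +
     of_real (K n * r ^ Suc n) * (b n * of_real (ibeta \<alpha> n (\<rho>\<^sup>2) * \<rho> ^ Suc n))) - of_real c * a 0" for N \<rho>
  have r2: "r\<^sup>2 \<in> {0..<1}" using r by (simp add: power_less_one_iff abs_square_less_1)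
  have cont_u: "continuous_on ?J (u n)" for n unfolding u_def by (intro continuous_intros continuous_on_cis)
  have cont_q: "continuous_on ?J (q N)" for N unfolding q_def by (intro continuous_intros cont_u)
  have S_le: "norm (of_real (2 * pi) * S N \<rho>) \<le> integral ?J (\<lambda>t. norm (q N t))" if \<rho>: "0 \<le> \<rho>" "\<rho> < 1" for N \<rho>
  proof -
    define g where "g t = f (of_real \<rho> * cis t)" for t
    have nz: "norm (of_real \<rho> * cis t) = \<rho>" for t using \<rho> by (simp add: norm_mult)
    have \<rho>2: "\<rho>\<^sup>2 \<in> {0..<1}" using \<rho> by (simp add: power_less_one_iff abs_square_less_1)
    have cont_g: "continuous_on ?J g"
      unfolding g_def
      by (rule continuous_on_compose2[OF cont]) (use nz \<rho> in \<open>auto intro!: continuous_intros continuous_on_cis simp: dist_norm\<close>)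
    have g: "(\<lambda>n. (a n * of_real (\<rho> ^ n)) * cis (real n * t) + (b n * of_real (ibeta \<alpha> n (\<rho>\<^sup>2) * \<rho> ^ Suc n)) * cis (- (real (Suc n) * t))) sums g t" for t
    proof -
      have e1: "(of_real \<rho> * cis t) ^ n = of_real (\<rho> ^ n) * cis (real n * t)" for n
        by (simp only: power_mult_distrib Complex.DeMoivre of_real_power)
      have e2: "cnj (of_real \<rho> * cis t) ^ Suc n = of_real (\<rho> ^ Suc n) * cis (- (real (Suc n) * t))" for n
        by (simp only: complex_cnj_mult cis_cnj complex_cnj_complex_of_real power_mult_distrib
          Complex.DeMoivre of_real_power mult_minus_right)
      show ?thesis
        using f[of "of_real \<rho> * cis t"] \<rho>(2) unfolding nz e1 e2 g_def by (simp add: mult_ac)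
    qed
    have sd: "summable (\<lambda>n. norm (b n * of_real (ibeta \<alpha> n (\<rho>\<^sup>2) * \<rho> ^ Suc n)))"
    proof (rule summable_comparison_test)
      define B where "B = max 1 ((1 - \<rho>\<^sup>2) powr \<alpha>)"
      show "summable (\<lambda>n. B * \<rho> * (norm (b n) * \<rho> ^ n))" by (intro summable_mult b \<rho>)
      have "norm (norm (b n * of_real (ibeta \<alpha> n (\<rho>\<^sup>2) * \<rho> ^ Suc n))) = ibeta \<alpha> n (\<rho>\<^sup>2) * (\<rho> * (norm (b n) * \<rho> ^ n))" for n
        using \<rho> by (simp add: norm_mult norm_power ibeta_nonneg mult_ac)
      also have "\<dots> n \<le> B * (\<rho> * (norm (b n) * \<rho> ^ n))" for n
        unfolding B_def by (rule mult_right_mono[OF ibeta_le[OF \<rho>2]]) (use \<rho> in auto)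
      finally show "\<exists>N. \<forall>n\<ge>N. norm (norm (b n * of_real (ibeta \<alpha> n (\<rho>\<^sup>2) * \<rho> ^ Suc n))) \<le> B * \<rho> * (norm (b n) * \<rho> ^ n)"
        by (simp only: mult.assoc) blast
    qed
    have sc: "summable (\<lambda>n. norm (a n * of_real (\<rho> ^ n)))"
      using a[OF \<rho>] \<rho> by (simp add: norm_mult norm_power)
    have i1: "((\<lambda>t. g t * cis (- (real n * t))) has_integral of_real (2 * pi) * (a n * of_real (\<rho> ^ n))) ?J" for n
      unfolding has_integral_cis_series(1)[OF sc sd g, symmetric]
      by (intro integrable_integral integrable_continuous_real continuous_intros continuous_on_cis cont_g)
    have i2: "((\<lambda>t. g t * cis (real (Suc n) * t)) has_integral of_real (2 * pi) * (b n * of_real (ibeta \<alpha> n (\<rho>\<^sup>2) * \<rho> ^ Suc n))) ?J" for n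
      unfolding has_integral_cis_series(2)[OF sc sd g, symmetric]
      by (intro integrable_integral integrable_continuous_real continuous_intros continuous_on_cis cont_g)
    have "((\<lambda>t. (\<Sum>n<N. of_real (r ^ n) * (g t * cis (- (real n * t))) + of_real (K n * r ^ Suc n) * (g t * cis (real (Suc n) * t)))
        - of_real c * (g t * cis (- (real 0 * t)))) has_integral
      (\<Sum>n<N. of_real (r ^ n) * (of_real (2 * pi) * (a n * of_real (\<rho> ^ n))) +
        of_real (K n * r ^ Suc n) * (of_real (2 * pi) * (b n * of_real (ibeta \<alpha> n (\<rho>\<^sup>2) * \<rho> ^ Suc n))))
        - of_real c * (of_real (2 * pi) * (a 0 * of_real (\<rho> ^ 0)))) ?J"
      by (intro has_integral_diff has_integral_sum has_integral_add has_integral_mult_right i1 i2 finite_lessThan)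
    also have "(\<lambda>t. (\<Sum>n<N. of_real (r ^ n) * (g t * cis (- (real n * t))) + of_real (K n * r ^ Suc n) * (g t * cis (real (Suc n) * t)))
        - of_real c * (g t * cis (- (real 0 * t)))) = (\<lambda>t. g t * q N t)"
    proof
      fix t
      show "(\<Sum>n<N. of_real (r ^ n) * (g t * cis (- (real n * t))) + of_real (K n * r ^ Suc n) * (g t * cis (real (Suc n) * t)))
        - of_real c * (g t * cis (- (real 0 * t))) = g t * q N t"
        unfolding q_def u_def right_diff_distrib sum_distrib_left distrib_left by (simp add: mult_ac)
    qed
    also have "(\<Sum>n<N. of_real (r ^ n) * (of_real (2 * pi) * (a n * of_real (\<rho> ^ n))) +
        of_real (K n * r ^ Suc n) * (of_real (2 * pi) * (b n * of_real (ibeta \<alpha> n (\<rho>\<^sup>2) * \<rho> ^ Suc n))))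
        - of_real c * (of_real (2 * pi) * (a 0 * of_real (\<rho> ^ 0))) = of_real (2 * pi) * S N \<rho>"
      unfolding S_def right_diff_distrib sum_distrib_left distrib_left by (simp add: mult_ac)
    finally have "of_real (2 * pi) * S N \<rho> = integral ?J (\<lambda>t. g t * q N t)"
      by (rule integral_unique[symmetric])
    also have "norm \<dots> \<le> integral ?J (\<lambda>t. norm (q N t))"
    proof (rule integral_norm_bound_integral)
      show "norm (g t * q N t) \<le> norm (q N t)" for t
        using bound[of "of_real \<rho> * cis t"] nz \<rho>(2) by (simp add: g_def norm_mult mult_left_le_one_le)
    qed (intro integrable_continuous_real continuous_intros cont_g cont_q)+
    finally show ?thesis .
  qed
  define S1 where "S1 N = (\<Sum>n<N. a n * of_real r ^ n + b n * of_real (ibeta \<alpha> n (r\<^sup>2)) * of_real r ^ Suc n) - of_real c * a 0" for N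
  have S1_le: "norm (S1 N) \<le> integral ?J (\<lambda>t. norm (q N t)) / (2 * pi)" for N
  proof -
    have ev: "\<forall>\<^sub>F \<rho> in at_left (1::real). \<rho> \<in> {0<..<1}"
      using eventually_at_left_real[of 0 1] by simp
    have sq: "filterlim (\<lambda>\<rho>::real. \<rho>\<^sup>2) (at_left 1) (at_left 1)"
      unfolding filterlim_at
    proof
      show "\<forall>\<^sub>F \<rho>::real in at_left 1. \<rho>\<^sup>2 \<in> {..<1} \<and> \<rho>\<^sup>2 \<noteq> 1"
        using ev by eventually_elim (auto simp: power_less_one_iff abs_square_less_1 power2_eq_1_iff)
    qed (auto intro!: tendsto_eq_intros)
    have "((\<lambda>\<rho>. S N \<rho>) \<longlongrightarrow> (\<Sum>n<N. of_real (r ^ n) * (a n * of_real (1 ^ n)) +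
       of_real (K n * r ^ Suc n) * (b n * of_real (fact n / pochhammer (\<alpha> + 1) (Suc n) * 1 ^ Suc n))) - of_real c * a 0) (at_left 1)"
      unfolding S_def by (intro tendsto_intros filterlim_compose[OF ibeta_tendsto[OF \<alpha>] sq])
    also have "(\<Sum>n<N. of_real (r ^ n) * (a n * of_real (1 ^ n)) +
       of_real (K n * r ^ Suc n) * (b n * of_real (fact n / pochhammer (\<alpha> + 1) (Suc n) * 1 ^ Suc n))) - of_real c * a 0 = S1 N"
    proof -
      \<comment> \<open>The normalisation of \<open>kernel_coeff\<close> cancels the beta value left
        by the limit, so the limit of \<open>S N\<close> is a partial sum of the series of f at r,
        minus \<open>c\<close> times its constant term.\<close>
      have "K n * (fact n / pochhammer (\<alpha> + 1) (Suc n)) = ibeta \<alpha> n (r\<^sup>2)" for n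
      proof -
        have "pochhammer (\<alpha> + 1) (Suc n) > 0" using \<alpha> by (intro pochhammer_pos) auto
        then show ?thesis by (simp add: K_def kernel_coeff_def del: pochhammer_Suc)
      qed
      then have "of_real (K n * r ^ Suc n) * (b n * of_real (fact n / pochhammer (\<alpha> + 1) (Suc n) * 1 ^ Suc n)) =
          b n * of_real (ibeta \<alpha> n (r\<^sup>2)) * of_real r ^ Suc n" for n
        by (metis (no_types, lifting) mult.commute mult.left_commute mult_1_right of_real_mult of_real_power power_one)
      then show ?thesis by (simp add: S1_def mult_ac)
    qed
    finally have "((\<lambda>\<rho>. norm (of_real (2 * pi) * S N \<rho>)) \<longlongrightarrow> norm (of_real (2 * pi) * S1 N)) (at_left 1)"
      by (intro tendsto_intros)
    then have "norm (of_real (2 * pi) * S1 N) \<le> integral ?J (\<lambda>t. norm (q N t))"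
    proof (rule tendsto_upperbound)
      show "\<forall>\<^sub>F \<rho> in at_left 1. norm (of_real (2 * pi) * S N \<rho>) \<le> integral ?J (\<lambda>t. norm (q N t))"
        by (rule eventually_mono[OF ev]) (rule S_le, auto)
    qed simp
    then show ?thesis by (simp add: norm_mult field_simps)
  qed
  have f0: "f 0 = a 0"
  proof -
    have "(\<lambda>n. a n * 0 ^ n + b n * of_real (ibeta \<alpha> n ((norm (0::complex))\<^sup>2)) * cnj 0 ^ Suc n) = (\<lambda>n. if n = 0 then a n else 0)"
      by (auto simp: fun_eq_iff)
    then have "(\<lambda>n. if n = 0 then a n else 0) sums f 0" using f[of 0] by simp
    then show ?thesis using sums_unique2[OF sums_single[of 0 a]] by simp
  qed
  have lim1: "(\<lambda>N. norm (S1 N)) \<longlonglongrightarrow> norm (f (of_real r) - of_real c * f 0)"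
    unfolding S1_def f0 using f[of "of_real r"] r by (intro tendsto_intros) (simp add: sums_def)
  \<comment> \<open>The target point is the real number r, so the kernel is evaluated at r times the
    conjugate of cis t.\<close>
  define p where "p t = poisson_kernel \<alpha> (of_real r * cis (- t)) - of_real c" for t
  have u_sums: "(\<lambda>n. u n t) sums poisson_kernel \<alpha> (of_real r * cis (- t))" for t
  proof -
    have n: "norm (of_real r * cis (- t)) = r" using r by (simp add: norm_mult)
    have e1: "(of_real r * cis (- t)) ^ n = of_real (r ^ n) * cis (- (real n * t))" for n
      by (simp only: power_mult_distrib Complex.DeMoivre of_real_power mult_minus_right)
    have e2: "cnj (of_real r * cis (- t)) ^ Suc n = of_real (r ^ Suc n) * cis (real (Suc n) * t)" for n
      by (simp only: complex_cnj_mult cis_cnj complex_cnj_complex_of_real power_mult_distrib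
        Complex.DeMoivre of_real_power minus_minus)
    show ?thesis
      using poisson_kernel_sums[OF \<alpha>, of "of_real r * cis (- t)"] r
      unfolding n e1 e2 u_def K_def by (simp add: mult_ac)
  qed
  have "uniform_limit ?J (\<lambda>N t. \<Sum>n<N. u n t) (\<lambda>t. \<Sum>n. u n t) sequentially"
  proof (rule Weierstrass_m_test)
    show "norm (u n t) \<le> r ^ n + K n * r ^ Suc n" for n t
      unfolding u_def by (rule norm_triangle_le)
        (use r kernel_coeff_nonneg[OF \<alpha>] in \<open>simp add: norm_mult norm_power K_def abs_mult\<close>)
    show "summable (\<lambda>n. r ^ n + K n * r ^ Suc n)"
      unfolding K_def by (intro summable_add summable_geometric summable_kernel_coeff \<alpha> r2) (use r in auto)
  qed
  moreover have "(\<Sum>n. u n t) = poisson_kernel \<alpha> (of_real r * cis (- t))" for t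
    using sums_unique[OF u_sums] by simp
  ultimately have ul: "uniform_limit ?J (\<lambda>N t. norm (q N t)) (\<lambda>t. norm (p t)) sequentially"
    unfolding q_def p_def by (intro uniform_limit_intros) simp
  obtain I L where IL: "\<And>N. ((\<lambda>t. norm (q N t)) has_integral I N) ?J" "((\<lambda>t. norm (p t)) has_integral L) ?J" "I \<longlonglongrightarrow> L"
    by (rule uniform_limit_integral[OF ul]) (auto intro!: continuous_intros cont_q)
  have "I = (\<lambda>N. integral ?J (\<lambda>t. norm (q N t)))" by (intro ext integral_unique[symmetric] IL(1))
  with IL(2,3) have lim2: "(\<lambda>N. integral ?J (\<lambda>t. norm (q N t)) / (2 * pi)) \<longlonglongrightarrow> integral ?J (\<lambda>t. norm (p t)) / (2 * pi)"
    by (intro tendsto_intros) (auto simp: integral_unique)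
  have le1: "norm (f (of_real r) - of_real c * f 0) \<le> integral ?J (\<lambda>t. norm (p t)) / (2 * pi)"
    by (rule LIMSEQ_le[OF lim1 lim2]) (use S1_le in auto)
  \<comment> \<open>\<open>E\<close> does not depend on t and survives the averaging unchanged; only
    \<open>G\<close> has to be integrated.\<close>
  define E where "E = (1 - r\<^sup>2) powr (\<alpha> + 1) * \<bar>(1 - r) powr (- \<alpha>) - 1\<bar> / (1 + r\<^sup>2)"
  define G where "G t = (1 - r\<^sup>2) powr (\<alpha> + 1) / (1 + r\<^sup>2) * (2 * r * \<bar>cos t\<bar>) * (1 + r\<^sup>2 - 2 * r * cos t) powr (- (1 + \<alpha>/2))" for t
  have pos: "1 + r\<^sup>2 - 2 * r * cos t > 0" for t
  proof -
    have "r * cos t \<le> r * 1" using r by (intro mult_left_mono) auto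
    moreover have "(1 - r)\<^sup>2 > 0" using r by simp
    ultimately show ?thesis by (simp add: power2_eq_square algebra_simps)
  qed
  have cont_G: "continuous_on ?J G"
    unfolding G_def by (intro continuous_intros) (metis pos less_irrefl)
  have "integral ?J (\<lambda>t. norm (p t)) \<le> integral ?J (\<lambda>t. E + G t)"
  proof (rule integral_le)
    show "(\<lambda>t. norm (p t)) integrable_on ?J" using IL(2) by blast
    show "(\<lambda>t. E + G t) integrable_on ?J" by (intro integrable_continuous_real continuous_intros cont_G)
    fix t
    have "norm (of_real r * cis (- t)) = r" using r by (simp add: norm_mult)
    from norm_poisson_kernel_diff_le[OF \<alpha> this r(2)] show "norm (p t) \<le> E + G t"
      using r by (simp add: p_def c_def E_def G_def abs_mult mult_ac)
  qed
  also have "\<dots> = 2 * pi * E + integral ?J G"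
    by (subst Henstock_Kurzweil_Integration.integral_add) (auto intro!: integrable_continuous_real cont_G)
  finally have "integral ?J (\<lambda>t. norm (p t)) / (2 * pi) \<le> E + integral ?J G / (2 * pi)"
    by (simp add: field_simps)
  also have "\<dots> \<le> schwarz_bound r \<alpha>"
    using schwarz_bound_integral[OF r \<alpha>] unfolding E_def G_def by simp
  finally show ?thesis using le1 by (simp add: c_def)
qed

section \<open>Series expansion of solutions\<close>

text \<open>Expressing Re v and Im v by v and cnj v splits the real differential into a
  complex-linear and a conjugate-linear part. Complex differentiability can then be read off from
  the vanishing of the latter.\<close>

lemma has_derivative_wirtinger:
  assumes "f differentiable (at z)"
  shows "(f has_derivative (\<lambda>v. wirtinger f z * v + wirtinger_bar f z * cnj v)) (at z)"
proof -
  define L where "L = frechet_derivative f (at z)"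
  have L: "(f has_derivative L) (at z)" using assms frechet_derivative_works L_def by blast
  then interpret bounded_linear L by (rule has_derivative_bounded_linear)
  have "L v = wirtinger f z * v + wirtinger_bar f z * cnj v" for v
  proof -
    have "v = Re v *\<^sub>R 1 + Im v *\<^sub>R \<i>" by (simp add: complex_eq_iff)
    then have "L v = L (Re v *\<^sub>R 1 + Im v *\<^sub>R \<i>)" by simp
    also have "\<dots> = Re v *\<^sub>R L 1 + Im v *\<^sub>R L \<i>"
      by (simp only: add scaleR)
    also have "\<dots> = of_real (Re v) * L 1 + of_real (Im v) * L \<i>"
      by (simp only: scaleR_conv_of_real)
    also have "of_real (Re v) = (v + cnj v) / 2" by (simp add: complex_eq_iff)
    also have "of_real (Im v) = - (\<i> * (v - cnj v) / 2)" by (simp add: complex_eq_iff)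
    finally show ?thesis
      by (simp add: wirtinger_def wirtinger_bar_def partial_x_def partial_y_def flip: L_def)
        (simp add: field_simps)
  qed
  then show ?thesis using L by presburger
qed

text \<open>The parameter s serves two uses: s = 1 is the weight in the operator, general s the
  integrand of \<open>wbar_primitive\<close>.\<close>

lemma has_derivative_one_minus_norm_powr:
  fixes z :: complex and s \<beta> :: real
  assumes "0 < 1 - s * (norm z)\<^sup>2"
  shows "((\<lambda>w. complex_of_real ((1 - s * (norm w)\<^sup>2) powr \<beta>)) has_derivative
     (\<lambda>v. of_real (- \<beta> * s * (1 - s * (norm z)\<^sup>2) powr (\<beta> - 1)) * (cnj z * v + z * cnj v))) (at z)"
proof -
  have "((\<lambda>y. (1 - s * y) powr \<beta>) has_real_derivative - \<beta> * s * (1 - s * (norm z)\<^sup>2) powr (\<beta> - 1)) (at ((norm z)\<^sup>2))"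
    using assms by (auto intro!: derivative_eq_intros)
  then have d1: "((\<lambda>y. (1 - s * y) powr \<beta>) has_derivative (\<lambda>x. - \<beta> * s * (1 - s * (norm z)\<^sup>2) powr (\<beta> - 1) * x)) (at ((norm z)\<^sup>2))"
    by (simp only: has_field_derivative_def)
  have d2: "((\<lambda>w::complex. (norm w)\<^sup>2) has_derivative (\<lambda>v. 2 * (z \<bullet> v))) (at z)"
    unfolding power2_norm_eq_inner by (auto intro!: derivative_eq_intros simp: inner_commute)
  have d3: "((\<lambda>w. complex_of_real ((1 - s * (norm w)\<^sup>2) powr \<beta>)) has_derivative
     (\<lambda>v. of_real (- \<beta> * s * (1 - s * (norm z)\<^sup>2) powr (\<beta> - 1) * (2 * (z \<bullet> v))))) (at z)"
    by (intro has_derivative_of_real has_derivative_compose[OF d2 d1])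
  have eq: "complex_of_real (2 * (z \<bullet> v)) = cnj z * v + z * cnj v" for v
    by (simp add: complex_eq_iff inner_complex_def algebra_simps)
  show ?thesis
    by (rule has_derivative_eq_rhs[OF d3])
      (simp only: eq of_real_mult[of "- \<beta> * s * (1 - s * (norm z)\<^sup>2) powr (\<beta> - 1)"])
qed

text \<open>The outer operator is \<open>wirtinger\<close>, so the equation leaves only a
  conjugate-linear differential, and conjugation makes it complex-linear. Differentiability of the
  first partial derivatives of f makes the weighted function real differentiable.\<close>

lemma weighted_laplacian_zero_imp_holomorphic:
  assumes C2: "C2_on (ball 0 1) f" and eq: "\<forall>w\<in>ball 0 1. weighted_laplacian \<alpha> f w = 0"
  shows "(\<lambda>w. cnj (of_real ((1 - (cmod w)\<^sup>2) powr (- \<alpha>)) * wirtinger_bar f w)) holomorphic_on ball 0 1"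
proof (rule holomorphic_onI)
  fix z :: complex assume z: "z \<in> ball 0 1"
  define g where "g w = of_real ((1 - (cmod w)\<^sup>2) powr (- \<alpha>)) * wirtinger_bar f w" for w
  have z2: "0 < 1 - 1 * (cmod z)\<^sup>2" using z by (simp add: abs_square_less_1)
  have "partial_x f differentiable (at z)" "partial_y f differentiable (at z)"
    using C2 z by (auto simp: C2_on_def C1_on_def)
  then obtain Dx Dy where D: "(partial_x f has_derivative Dx) (at z)" "(partial_y f has_derivative Dy) (at z)"
    by (auto simp: differentiable_def)
  have "(wirtinger_bar f has_derivative (\<lambda>v. (Dx v + \<i> * Dy v) / 2)) (at z)"
    unfolding wirtinger_bar_def[abs_def] by (auto intro!: derivative_eq_intros D)
  from has_derivative_mult[OF has_derivative_one_minus_norm_powr[OF z2, of "- \<alpha>"] this]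
  have "g differentiable (at z)"
    unfolding g_def[abs_def] differentiable_def by auto
  from has_derivative_wirtinger[OF this]
  have "(g has_derivative (\<lambda>v. wirtinger_bar g z * cnj v)) (at z)"
    using eq z by (simp add: weighted_laplacian_def g_def[abs_def])
  from has_derivative_cnj[OF this]
  have "((\<lambda>w. cnj (g w)) has_field_derivative cnj (wirtinger_bar g z)) (at z)"
    by (simp add: has_field_derivative_def)
  then show "(\<lambda>w. cnj (of_real ((1 - (cmod w)\<^sup>2) powr (- \<alpha>)) * wirtinger_bar f w)) field_differentiable at z within ball 0 1"
    unfolding g_def field_differentiable_def using has_field_derivative_at_within by blast
qed

text \<open>Formally z and cnj z are independent variables: with z fixed, the function (1 - z
  y)^\<alpha> times the conjugate of G at cnj y is integrated over y = s cnj z. Hence the weight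
  contains s |z|^2 and not s^2 |z|^2.\<close>

definition wbar_primitive :: "real \<Rightarrow> (complex \<Rightarrow> complex) \<Rightarrow> complex \<Rightarrow> complex" where
  "wbar_primitive \<alpha> G z =
     integral {0..1} (\<lambda>s. cnj z * of_real ((1 - s * (norm z)\<^sup>2) powr \<alpha>) * cnj (G (of_real s * z)))"

text \<open>Only the coefficient of cnj v has to be identified; \<open>P\<close> may stay
  unspecified because it is complex-linear and will be absorbed into the derivative of a holomorphic
  difference.\<close>

lemma has_derivative_wbar_primitive:
  assumes G: "G holomorphic_on ball 0 1" and z: "z \<in> ball 0 1"
  shows "\<exists>P. (wbar_primitive \<alpha> G has_derivative
     (\<lambda>v. P * v + of_real ((1 - (norm z)\<^sup>2) powr \<alpha>) * cnj (G z) * cnj v)) (at z)"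
proof -
  let ?U = "ball (0::complex) 1"
  define W where "W z s = 1 - s * (norm z)\<^sup>2" for z :: complex and s :: real
  define P where "P z s = cnj z * (of_real (- \<alpha> * s * W z s powr (\<alpha> - 1)) * cnj z) * cnj (G (of_real s * z))" for z s
  define Q where "Q z s = of_real (W z s powr \<alpha>) * cnj (G (of_real s * z)) +
     cnj z * (of_real (- \<alpha> * s * W z s powr (\<alpha> - 1)) * z) * cnj (G (of_real s * z)) +
     cnj z * of_real (W z s powr \<alpha>) * (of_real s * cnj (deriv G (of_real s * z)))" for z s
  \<comment> \<open>Leibniz's rule takes the derivative as a continuous family of bounded linear
    maps; conjugation, being real-linear, enters as such a map.\<close>
  define C where "C = Blinfun cnj"
  have C: "blinfun_apply C v = cnj v" for v
    unfolding C_def by (simp add: bounded_linear_Blinfun_apply bounded_linear_cnj)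
  define D where "D z s = blinfun_mult_right (P z s) + (blinfun_mult_right (Q z s) o\<^sub>L C)" for z s
  have D: "blinfun_apply (D z s) v = P z s * v + Q z s * cnj v" for z s v
    by (simp add: D_def C blinfun.add_left)
  have W: "0 < W z s" if "z \<in> ?U" "s \<in> {0..1}" for z s
    unfolding W_def using that by (intro one_minus_mult_pos) (auto simp: abs_square_less_1)
  have sz: "of_real s * z \<in> ?U" if "z \<in> ?U" "s \<in> {0..1}" for z :: complex and s :: real
    using that mult_left_le_one_le[of "norm z" s] by (simp add: norm_mult)
  have contG: "continuous_on (?U \<times> {0..1}) (\<lambda>x. G (of_real (snd x) * fst x))"
    by (rule continuous_on_compose2[OF holomorphic_on_imp_continuous_on[OF G]])
      (use sz in \<open>auto intro!: continuous_intros\<close>)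
  have contG': "continuous_on (?U \<times> {0..1}) (\<lambda>x. deriv G (of_real (snd x) * fst x))"
    by (rule continuous_on_compose2[OF holomorphic_on_imp_continuous_on[OF holomorphic_deriv[OF G open_ball]]])
      (use sz in \<open>auto intro!: continuous_intros\<close>)
  have contW: "continuous_on (?U \<times> {0..1}) (\<lambda>x. W (fst x) (snd x) powr \<beta>)" for \<beta>
  proof (rule continuous_on_powr)
    show "\<forall>x\<in>?U \<times> {0..1}. W (fst x) (snd x) \<noteq> 0" using W by fastforce
  qed (auto simp: W_def intro!: continuous_intros)
  have contP: "continuous_on (?U \<times> {0..1}) (\<lambda>x. P (fst x) (snd x))"
    unfolding P_def by (intro continuous_intros contG contW)
  have contQ: "continuous_on (?U \<times> {0..1}) (\<lambda>x. Q (fst x) (snd x))"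
    unfolding Q_def by (intro continuous_intros contG contG' contW)
  have contD: "continuous_on (?U \<times> {0..1}) (\<lambda>(z, s). D z s)"
    unfolding D_def split_beta by (intro continuous_intros contP contQ bounded_linear_intros)
  have contz: "continuous_on {0..1} (h z)" if "continuous_on (?U \<times> {0..1}) (\<lambda>x. h (fst x) (snd x))" "z \<in> ?U"
    for h :: "complex \<Rightarrow> real \<Rightarrow> 'b::topological_space" and z
  proof -
    have "continuous_on {0..1} (\<lambda>s. h (fst (z, s)) (snd (z, s)))"
      by (rule continuous_on_compose2[OF that(1)]) (use that(2) in \<open>auto intro!: continuous_on_Pair\<close>)
    then show ?thesis by simp
  qed
  have "((\<lambda>z. integral (cbox 0 1) (\<lambda>s. cnj z * of_real ((1 - s * (norm z)\<^sup>2) powr \<alpha>) * cnj (G (of_real s * z))))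
     has_derivative integral (cbox 0 1) (D z)) (at z within ?U)"
  proof (rule leibniz_rule)
    fix z s assume zs: "z \<in> ?U" "s \<in> cbox 0 (1::real)"
    then have s: "s \<in> {0..1}" by simp
    have "(G has_field_derivative deriv G (of_real s * z)) (at (of_real s * z))"
      by (rule holomorphic_derivI[OF G open_ball sz[OF zs(1) s]])
    then have dG: "(G has_derivative (\<lambda>v. deriv G (of_real s * z) * v)) (at (of_real s * z))"
      by (simp add: has_field_derivative_def)
    have ds: "((\<lambda>z. of_real s * z) has_derivative (\<lambda>v. of_real s * v)) (at z)"
      by (auto intro!: derivative_eq_intros)
    have dGs: "((\<lambda>z. cnj (G (of_real s * z))) has_derivative (\<lambda>v. cnj (deriv G (of_real s * z) * (of_real s * v)))) (at z)"
      by (intro has_derivative_cnj has_derivative_compose[OF ds dG])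
    have dc: "(cnj has_derivative cnj) (at z)"
      by (rule bounded_linear_imp_has_derivative[OF bounded_linear_cnj])
    have dW: "((\<lambda>z. complex_of_real ((1 - s * (norm z)\<^sup>2) powr \<alpha>)) has_derivative
       (\<lambda>v. of_real (- \<alpha> * s * (1 - s * (norm z)\<^sup>2) powr (\<alpha> - 1)) * (cnj z * v + z * cnj v))) (at z)"
      using W[OF zs(1) s] by (intro has_derivative_one_minus_norm_powr) (simp add: W_def)
    have "((\<lambda>z. cnj z * of_real ((1 - s * (norm z)\<^sup>2) powr \<alpha>) * cnj (G (of_real s * z)))
      has_derivative blinfun_apply (D z s)) (at z)"
    proof (rule has_derivative_eq_rhs[OF has_derivative_mult[OF has_derivative_mult[OF dc dW] dGs]])
      define w where "w = W z s powr (\<alpha> - 1)"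
      define w' where "w' = W z s powr \<alpha>"
      show "(\<lambda>h. cnj z * of_real ((1 - s * (norm z)\<^sup>2) powr \<alpha>) * cnj (deriv G (of_real s * z) * (of_real s * h)) +
          (cnj z * (of_real (- \<alpha> * s * (1 - s * (norm z)\<^sup>2) powr (\<alpha> - 1)) * (cnj z * h + z * cnj h)) +
           cnj h * of_real ((1 - s * (norm z)\<^sup>2) powr \<alpha>)) * cnj (G (of_real s * z))) = blinfun_apply (D z s)"
        unfolding D[abs_def] P_def Q_def W_def[symmetric] w_def[symmetric] w'_def[symmetric]
        by (simp add: fun_eq_iff D P_def Q_def algebra_simps flip: w_def w'_def)
    qed
    then show "((\<lambda>z. cnj z * of_real ((1 - s * (norm z)\<^sup>2) powr \<alpha>) * cnj (G (of_real s * z)))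
      has_derivative blinfun_apply (D z s)) (at z within ?U)"
      by (rule has_derivative_at_withinI)
  next
    fix z assume z: "z \<in> ?U"
    have "continuous_on {0..1} ((\<lambda>z s. cnj z * of_real (W z s powr \<alpha>) * cnj (G (of_real s * z))) z)"
      by (rule contz[OF _ z]) (intro continuous_intros contG contW)
    then show "(\<lambda>s. cnj z * of_real ((1 - s * (norm z)\<^sup>2) powr \<alpha>) * cnj (G (of_real s * z))) integrable_on cbox 0 1"
      unfolding W_def by (simp add: integrable_continuous_real)
  qed (use contD z in auto)
  then have "(wbar_primitive \<alpha> G has_derivative integral {0..1} (D z)) (at z)"
    unfolding wbar_primitive_def[abs_def] using z by (simp add: at_within_open[of z ?U])
  moreover have "blinfun_apply (integral {0..1} (D z)) v =
      integral {0..1} (P z) * v + of_real ((1 - (norm z)\<^sup>2) powr \<alpha>) * cnj (G z) * cnj v" for v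
  proof -
    have "continuous_on {0..1} (D z)" using contz[of D] contD z by (simp add: split_beta)
    then have "blinfun_apply (integral {0..1} (D z)) v = integral {0..1} (\<lambda>s. P z s * v + Q z s * cnj v)"
      by (subst blinfun_apply_integral) (auto simp: D intro: integrable_continuous_real)
    also have "\<dots> = integral {0..1} (P z) * v + integral {0..1} (Q z) * cnj v"
      using contz[OF contP z] contz[OF contQ z]
      by (subst Henstock_Kurzweil_Integration.integral_add)
        (auto intro!: integrable_continuous_real continuous_intros)
    \<comment> \<open>As a function of s, \<open>Q z\<close> is the exact derivative of s (1 - s
      |z|^2)^\<alpha> cnj (G (s z)), so its integral is the value at s = 1.\<close>
    also have "(Q z has_integral of_real 1 * of_real (W z 1 powr \<alpha>) * cnj (G (of_real 1 * z)) -
        of_real 0 * of_real (W z 0 powr \<alpha>) * cnj (G (of_real 0 * z))) {0..1}"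
    proof (rule fundamental_theorem_of_calculus)
      fix s :: real assume s: "s \<in> {0..1}"
      have d1: "((\<lambda>s. complex_of_real s) has_vector_derivative 1) (at s within {0..1})"
        by (auto intro!: derivative_eq_intros)
      have "((\<lambda>s. W z s powr \<alpha>) has_real_derivative - \<alpha> * (norm z)\<^sup>2 * W z s powr (\<alpha> - 1)) (at s within {0..1})"
        using W[OF z s] unfolding W_def by (auto intro!: derivative_eq_intros)
      then have d2: "((\<lambda>s. complex_of_real (W z s powr \<alpha>)) has_vector_derivative of_real (- \<alpha> * (norm z)\<^sup>2 * W z s powr (\<alpha> - 1))) (at s within {0..1})"
        by (intro has_vector_derivative_of_real) (simp add: has_real_derivative_iff_has_vector_derivative)
      have "((\<lambda>y. G (y * z)) has_field_derivative deriv G (of_real s * z) * z) (at (of_real s))"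
        by (rule DERIV_chain2[where g = "\<lambda>y. y * z", OF holomorphic_derivI[OF G open_ball sz[OF z s]] DERIV_cmult_Id[of z, unfolded mult.commute[of z]]])
      from has_vector_derivative_cnj[OF has_vector_derivative_real_field[OF this]]
      have d3: "((\<lambda>s. cnj (G (of_real s * z))) has_vector_derivative cnj (deriv G (of_real s * z) * z)) (at s within {0..1})" .
      have zz: "complex_of_real ((norm z)\<^sup>2) = z * cnj z" by (rule complex_norm_square)
      show "((\<lambda>s. of_real s * of_real (W z s powr \<alpha>) * cnj (G (of_real s * z))) has_vector_derivative Q z s) (at s within {0..1})"
        by (rule has_vector_derivative_eq_rhs[OF has_vector_derivative_mult[OF has_vector_derivative_mult[OF d1 d2] d3]])
          (simp add: Q_def zz algebra_simps del: of_real_power)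
    qed simp
    then have "integral {0..1} (Q z) = of_real ((1 - (norm z)\<^sup>2) powr \<alpha>) * cnj (G z)"
      by (simp add: W_def integral_unique)
    finally show ?thesis .
  qed
  ultimately have "(wbar_primitive \<alpha> G has_derivative
     (\<lambda>v. integral {0..1} (P z) * v + of_real ((1 - (norm z)\<^sup>2) powr \<alpha>) * cnj (G z) * cnj v)) (at z)"
    by (rule has_derivative_eq_rhs[OF _ ext])
  then show ?thesis by blast
qed

lemma summable_norm_taylor:
  assumes F: "F holomorphic_on ball 0 1" and \<rho>: "0 \<le> \<rho>" "\<rho> < 1"
  shows "summable (\<lambda>n. norm ((deriv ^^ n) F 0 / fact n) * \<rho> ^ n)"
proof -
  have "summable (\<lambda>n. norm ((deriv ^^ n) F 0 / fact n * of_real \<rho> ^ n))"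
  proof (rule powser_insidea)
    have n: "norm (complex_of_real ((1 + \<rho>) / 2)) = (1 + \<rho>) / 2" using \<rho> by (subst norm_of_real) simp
    show "summable (\<lambda>n. (deriv ^^ n) F 0 / fact n * of_real ((1 + \<rho>) / 2) ^ n)"
    proof (rule sums_summable)
      have "complex_of_real ((1 + \<rho>) / 2) \<in> ball 0 1" unfolding mem_ball_0 n using \<rho> by simp
      from holomorphic_power_series[OF F this]
      show "(\<lambda>n. (deriv ^^ n) F 0 / fact n * of_real ((1 + \<rho>) / 2) ^ n) sums F (of_real ((1 + \<rho>) / 2))"
        unfolding diff_zero .
    qed
    show "norm (complex_of_real \<rho>) < norm (complex_of_real ((1 + \<rho>) / 2))" unfolding n using \<rho> by simp
  qed
  then show ?thesis unfolding norm_mult norm_power norm_of_real using \<rho> by simp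
qed

text \<open>In the Taylor series of G at s z the power s^n is the one in the integrand of
  \<open>ibeta\<close>, and the prefactor cnj z raises the exponent from n to n + 1.\<close>

lemma wbar_primitive_sums:
  assumes G: "G holomorphic_on ball 0 1" and z: "norm z < 1"
  shows "(\<lambda>n. cnj ((deriv ^^ n) G 0 / fact n) * of_real (ibeta \<alpha> n ((norm z)\<^sup>2)) * cnj z ^ Suc n) sums wbar_primitive \<alpha> G z"
proof -
  define \<beta> where "\<beta> n = (deriv ^^ n) G 0 / fact n" for n
  define t where "t = (norm z)\<^sup>2"
  have t: "t \<in> {0..<1}" using z by (simp add: t_def abs_square_less_1)
  define B where "B = max 1 ((1 - t) powr \<alpha>)"
  define u where "u n s = cnj (\<beta> n) * of_real (s ^ n * (1 - s * t) powr \<alpha>) * cnj z ^ Suc n" for n and s :: real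
  have "(\<lambda>n. integral {0..1} (u n)) sums integral {0..1} (\<lambda>s. \<Sum>n. u n s)"
  proof (rule sums_integral_Weierstrass)
    show "continuous_on {0..1} (u n)" for n
      unfolding u_def by (intro continuous_intros continuous_on_ibeta_integrand t)
    show "summable (\<lambda>n. B * norm z * (norm (\<beta> n) * norm z ^ n))"
      unfolding \<beta>_def by (intro summable_mult summable_norm_taylor G z norm_ge_zero)
    fix n and s :: real assume s: "s \<in> {0..1}"
    have "norm (u n s) = (s ^ n * (1 - s * t) powr \<alpha>) * (norm z * (norm (\<beta> n) * norm z ^ n))"
      unfolding u_def norm_mult norm_of_real norm_power complex_mod_cnj using s by (simp add: abs_mult)
    also have "\<dots> \<le> (1 * B) * (norm z * (norm (\<beta> n) * norm z ^ n))"
      unfolding B_def using s by (intro mult_right_mono mult_mono one_minus_mult_powr_le[OF t s]) (auto simp: power_le_one)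
    finally show "norm (u n s) \<le> B * norm z * (norm (\<beta> n) * norm z ^ n)"
      by (simp add: mult.assoc)
  qed
  moreover have "integral {0..1} (u n) = cnj (\<beta> n) * of_real (ibeta \<alpha> n t) * cnj z ^ Suc n" for n
    unfolding u_def[abs_def]
    by (intro integral_unique has_integral_mult_left has_integral_mult_right has_integral_of_real has_integral_ibeta t)
  moreover have "integral {0..1} (\<lambda>s. \<Sum>n. u n s) = wbar_primitive \<alpha> G z"
    unfolding wbar_primitive_def
  proof (rule integral_cong)
    fix s :: real assume s: "s \<in> {0..1}"
    have "norm (of_real s * z) < 1"
      using s z mult_left_le_one_le[of "norm z" s] by (simp add: norm_mult)
    then have "(\<lambda>n. \<beta> n * (of_real s * z) ^ n) sums G (of_real s * z)"
      using holomorphic_power_series[OF G, of "of_real s * z"] by (simp add: \<beta>_def)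
    then have "(\<lambda>n. cnj (\<beta> n * (of_real s * z) ^ n)) sums cnj (G (of_real s * z))"
      by (simp only: sums_cnj)
    from sums_mult[OF this, of "cnj z * of_real ((1 - s * t) powr \<alpha>)"]
    have "(\<lambda>n. u n s) sums (cnj z * of_real ((1 - s * t) powr \<alpha>) * cnj (G (of_real s * z)))"
      by (simp add: u_def power_mult_distrib mult_ac)
    then show "(\<Sum>n. u n s) = cnj z * of_real ((1 - s * (norm z)\<^sup>2) powr \<alpha>) * cnj (G (of_real s * z))"
      unfolding t_def by (rule sums_unique[symmetric])
  qed
  ultimately show ?thesis by (simp add: \<beta>_def t_def)
qed

lemma weighted_harmonic_series:
  assumes C2: "C2_on (ball 0 1) f" and eq: "\<forall>w\<in>ball 0 1. weighted_laplacian \<alpha> f w = 0"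
  obtains a b where
    "\<And>\<rho>. 0 \<le> \<rho> \<Longrightarrow> \<rho> < 1 \<Longrightarrow> summable (\<lambda>n. norm (a n) * \<rho> ^ n)"
    "\<And>\<rho>. 0 \<le> \<rho> \<Longrightarrow> \<rho> < 1 \<Longrightarrow> summable (\<lambda>n. norm (b n) * \<rho> ^ n)"
    "\<And>z. norm z < 1 \<Longrightarrow>
      (\<lambda>n. a n * z ^ n + b n * of_real (ibeta \<alpha> n ((norm z)\<^sup>2)) * cnj z ^ Suc n) sums f z"
proof -
  define G where "G w = cnj (of_real ((1 - (cmod w)\<^sup>2) powr (- \<alpha>)) * wirtinger_bar f w)" for w
  have G: "G holomorphic_on ball 0 1"
    unfolding G_def[abs_def] by (rule weighted_laplacian_zero_imp_holomorphic[OF C2 eq])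
  define A where "A z = f z - wbar_primitive \<alpha> G z" for z
  have A: "A holomorphic_on ball 0 1"
  proof (rule holomorphic_onI)
    fix z :: complex assume z: "z \<in> ball 0 1"
    obtain P where P: "(wbar_primitive \<alpha> G has_derivative
       (\<lambda>v. P * v + of_real ((1 - (norm z)\<^sup>2) powr \<alpha>) * cnj (G z) * cnj v)) (at z)"
      using has_derivative_wbar_primitive[OF G z] by blast
    have "(norm z)\<^sup>2 < 1" using z by (simp add: abs_square_less_1)
    then have "of_real ((1 - (norm z)\<^sup>2) powr \<alpha>) * cnj (G z) = wirtinger_bar f z"
      by (simp add: G_def powr_minus)
    moreover have "f differentiable (at z)" using C2 z by (auto simp: C2_on_def C1_on_def)
    \<comment> \<open>The conjugate-linear parts of f and of the primitive agree and cancel, which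
      leaves a complex-linear differential.\<close>
    ultimately have "(A has_derivative (\<lambda>v. wirtinger f z * v + wirtinger_bar f z * cnj v -
        (P * v + wirtinger_bar f z * cnj v))) (at z)"
      unfolding A_def[abs_def] using has_derivative_diff[OF has_derivative_wirtinger P] by metis
    then have "(A has_derivative (\<lambda>v. (wirtinger f z - P) * v)) (at z)"
      by (rule has_derivative_eq_rhs) (simp add: fun_eq_iff algebra_simps)
    then have "(A has_field_derivative (wirtinger f z - P)) (at z)"
      by (simp only: has_field_derivative_def)
    then show "A field_differentiable at z within ball 0 1"
      unfolding field_differentiable_def using has_field_derivative_at_within by blast
  qed
  show ?thesis
  proof (rule that)
    show "summable (\<lambda>n. norm ((deriv ^^ n) A 0 / fact n) * \<rho> ^ n)"
      "summable (\<lambda>n. norm (cnj ((deriv ^^ n) G 0 / fact n)) * \<rho> ^ n)" if "0 \<le> \<rho>" "\<rho> < 1" for \<rho>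
      using summable_norm_taylor[OF A that] summable_norm_taylor[OF G that]
      unfolding complex_mod_cnj by simp_all
    fix z :: complex assume z: "norm z < 1"
    have "(\<lambda>n. (deriv ^^ n) A 0 / fact n * z ^ n) sums A z"
      using holomorphic_power_series[OF A, of z] z by simp
    from sums_add[OF this wbar_primitive_sums[OF G z, of \<alpha>]]
    show "(\<lambda>n. (deriv ^^ n) A 0 / fact n * z ^ n +
       cnj ((deriv ^^ n) G 0 / fact n) * of_real (ibeta \<alpha> n ((norm z)\<^sup>2)) * cnj z ^ Suc n) sums f z"
      by (simp add: A_def)
  qed
qed

section \<open>The Schwarz-type inequality\<close>

theorem theorem2p1:
  fixes \<alpha> :: real and f fstar :: "complex \<Rightarrow> complex" and z :: complex
  assumes "\<alpha> > -1"
    and "continuous_on (sphere 0 1) fstar"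
    and "C2_on (ball 0 1) f"
    and "\<forall>w\<in>ball 0 1. weighted_laplacian \<alpha> f w = 0"
    and "has_distributional_boundary_value f fstar"
    and "f ` ball 0 1 \<subseteq> ball 0 1"
    and "z \<in> ball 0 1"
  shows "cmod (f z - of_real ((1 - (cmod z)\<^sup>2) powr (\<alpha> + 1) / (1 + (cmod z)\<^sup>2)) * f 0)
           \<le> schwarz_bound (cmod z) \<alpha>"
proof -
  obtain a b where
    a: "\<And>\<rho>. 0 \<le> \<rho> \<Longrightarrow> \<rho> < 1 \<Longrightarrow> summable (\<lambda>n. norm (a n) * \<rho> ^ n)" and
    b: "\<And>\<rho>. 0 \<le> \<rho> \<Longrightarrow> \<rho> < 1 \<Longrightarrow> summable (\<lambda>n. norm (b n) * \<rho> ^ n)" and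
    f: "\<And>z. norm z < 1 \<Longrightarrow>
      (\<lambda>n. a n * z ^ n + b n * of_real (ibeta \<alpha> n ((norm z)\<^sup>2)) * cnj z ^ Suc n) sums f z"
    using weighted_harmonic_series[OF assms(3,4)] by blast
  \<comment> \<open>A rotation moves z to the nonnegative real axis. It preserves the weights, which
    depend on the modulus only, and its powers are absorbed into the coefficients of the
    series.\<close>
  define \<omega> where "\<omega> = cis (Arg z)"
  have \<omega>: "norm \<omega> = 1" "of_real (cmod z) * \<omega> = z"
    using Arg_eq[of z] by (cases "z = 0"; simp add: \<omega>_def cis_conv_exp)+
  have cont: "continuous_on (ball 0 1) f"
    using assms(3) unfolding C2_on_def C1_on_def
    by (auto intro!: continuous_at_imp_continuous_on differentiable_imp_continuous_within)
  have "norm (f (of_real (cmod z) * \<omega>) - of_real ((1 - (cmod z)\<^sup>2) powr (\<alpha> + 1) / (1 + (cmod z)\<^sup>2)) * f (0 * \<omega>))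
      \<le> schwarz_bound (cmod z) \<alpha>"
  proof (rule series_representation_bound[where f = "\<lambda>w. f (w * \<omega>)" and a = "\<lambda>n. a n * \<omega> ^ n" and b = "\<lambda>n. b n * cnj \<omega> ^ Suc n"])
    show "continuous_on (ball 0 1) (\<lambda>w. f (w * \<omega>))"
      by (rule continuous_on_compose2[OF cont]) (use \<omega> in \<open>auto intro!: continuous_intros simp: norm_mult\<close>)
    show "summable (\<lambda>n. norm (a n * \<omega> ^ n) * \<rho> ^ n)" "summable (\<lambda>n. norm (b n * cnj \<omega> ^ Suc n) * \<rho> ^ n)"
      if "0 \<le> \<rho>" "\<rho> < 1" for \<rho>
      using a[OF that] b[OF that] \<omega>(1) unfolding norm_mult norm_power complex_mod_cnj by simp_all
    fix w :: complex assume w: "norm w < 1"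
    then have w\<omega>: "norm (w * \<omega>) = norm w" using \<omega> by (simp add: norm_mult)
    then have "w * \<omega> \<in> ball 0 1" using w by simp
    then have "f (w * \<omega>) \<in> ball 0 1" using assms(6) by blast
    then show "norm (f (w * \<omega>)) \<le> 1" by simp
    show "(\<lambda>n. a n * \<omega> ^ n * w ^ n + b n * cnj \<omega> ^ Suc n * of_real (ibeta \<alpha> n ((norm w)\<^sup>2)) * cnj w ^ Suc n) sums f (w * \<omega>)"
      using f[of "w * \<omega>"] w unfolding w\<omega> complex_cnj_mult power_mult_distrib by (simp add: mult_ac)
  qed (use assms in auto)
  then show ?thesis by (simp add: \<omega>(2))
qed

end
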